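(* Let $d\geq 2$ be a positive integer and let $K$ be a convex Kakeya body in $\mathbb{R}^d$, i.e. a compact convex set such that for every $v\in\mathbb{S}^{d-1}$ there is some $w\in K$ with $w+tv\in K$ for all $t\in[0,1]$. Then any two unit segments can be rotated into each other within $K$; that is, if $S\subseteq\mathbb{R}^d$ is a line segment of length $1$, then any two $S$-copies can be rotated into each other within $K$.
   Context: $\mathbb{S}^{d-1}$ is the unit sphere in $\mathbb{R}^d$. For $S,K\subseteq\mathbb{R}^d$, we say that any two $S$-copies can be rotated into each other within $K$ if whenever $\rho_0,\rho_1\in \operatorname{SO}(d)$ and $w_0,w_1\in\mathbb{R}^d$ satisfy $\rho_i(S)+w_i\subseteq K$ for $i=0,1$, there are continuous functions $\gamma:[0,1]\to\operatorname{SO}(d)$ and $\delta:[0,1]\to\mathbb{R}^d$ such that $\gamma(i)=\rho_i$ and $\delta(i)=w_i$ for $i=0,1$, and $\gamma(t)(S)+\delta(t)\subseteq K$ for all $t\in[0,1]$. *)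

theory Defs
  imports "HOL-Analysis.Analysis"
begin

definition special_orthogonal :: "(real ^ 'n ^ 'n) set" where
  "special_orthogonal = {A. rotation_matrix A}"

(* The set rho(S) + w. *)
definition rigid_copy ::
    "real ^ 'n ^ 'n \<Rightarrow> real ^ 'n \<Rightarrow> (real ^ 'n) set \<Rightarrow> (real ^ 'n) set" where
  "rigid_copy \<rho> w S = (\<lambda>x. \<rho> *v x + w) ` S"

(* Continuity of the path of rotations is with respect to the Euclidean (entrywise) topology
   on matrices, which induces the usual topology of SO(d). *)
definition copies_rotatable_within :: "(real ^ 'n) set \<Rightarrow> (real ^ 'n) set \<Rightarrow> bool" where
  "copies_rotatable_within S K \<longleftrightarrow>
    (\<forall>\<rho>\<^sub>0\<in>special_orthogonal. \<forall>\<rho>\<^sub>1\<in>special_orthogonal. \<forall>w\<^sub>0 w\<^sub>1.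
      rigid_copy \<rho>\<^sub>0 w\<^sub>0 S \<subseteq> K \<and> rigid_copy \<rho>\<^sub>1 w\<^sub>1 S \<subseteq> K \<longrightarrow>
      (\<exists>\<gamma> \<delta>. continuous_on {0..1::real} \<gamma> \<and> \<gamma> ` {0..1} \<subseteq> special_orthogonal \<and>
             continuous_on {0..1::real} \<delta> \<and>
             \<gamma> 0 = \<rho>\<^sub>0 \<and> \<gamma> 1 = \<rho>\<^sub>1 \<and> \<delta> 0 = w\<^sub>0 \<and> \<delta> 1 = w\<^sub>1 \<and>
             (\<forall>t\<in>{0..1}. rigid_copy (\<gamma> t) (\<delta> t) S \<subseteq> K)))"

definition convex_kakeya_body :: "(real ^ 'n) set \<Rightarrow> bool" where
  "convex_kakeya_body K \<longleftrightarrow> compact K \<and> convex K \<and>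
    (\<forall>v\<in>sphere 0 1. \<exists>w\<in>K. \<forall>t\<in>{0..1}. w + t *\<^sub>R v \<in> K)"

end

theory Submission
  imports Defs "HOL-Complex_Analysis.Great_Picard"
begin

text \<open>
A placement of the segment in \<open>K\<close> determines a unit chord of \<open>K\<close>, that is, a pair \<open>(x, y)\<close> of points of
\<open>K\<close> with \<open>norm (y - x) = 1\<close>. The placements with the same chord form a path-connected set, because the
rotations that fix a vector do (\<open>rotation_stabiliser_path_component\<close>), and paths of chords lift to
paths of placements (\<open>configurations_lift\<close>). Chords of length at least 1 can be shortened to unit chords.
So the theorem is reduced to \<open>path_connected_long_chords\<close>: the chords of length at least 1 form a
path-connected set.

By the Kakeya property \<open>K\<close> has width at least 1 in every direction. Hence for \<open>v \<noteq> 0\<close> every pair \<open>(x, y)\<close>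
that maximises \<open>v \<bullet> (y - x)\<close> over \<open>K \<times> K\<close>, called a supporting pair below, is a chord of length at least 1.
If \<open>K\<close> is strictly convex, this pair is unique, depends continuously on \<open>v\<close>, and connects everything. In
general the supporting pairs in a direction form a convex set that may jump and even oscillate
when \<open>v\<close> varies, so that not every path of directions lifts to a path of supporting pairs.

The directions on almost every line parallel to an axis do lift. The point \<open>y\<close> is a gradient of the support
function of \<open>K\<close>, so its derivative is a positive semidefinite symmetric matrix, whose entries are bounded
by its trace; the integral of the trace over a region is bounded, since \<open>y\<close> is bounded. Therefore the length of the
curve traced by \<open>y\<close> along a line is bounded on average over parallel lines. This is carried out with
finite differences for a regularised, continuous version of \<open>y\<close> (\<open>gradient_increment_bound\<close>,
\<open>average_gradient_increment\<close>). By Fatou's lemma, almost every line carries infinitely many approximating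
chains of bounded length, and by the theorem of Arzela and Ascoli these have a limit path
(\<open>supporting_bundle_path_over_segment\<close>), in which jumps are filled by segments in the convex fibres.
It follows that all axis-parallel segments with rational length that start in a suitable dense grid of
directions lift (\<open>exists_lifting_grid\<close>). As the space without 0 is connected in dimension at
least 2, all supporting pairs in grid directions are connected with each other.

It remains to connect an arbitrary chord \<open>p = (x, y)\<close> of length at least 1 to these
(\<open>path_component_from_grid\<close>). Let \<open>v = y - x\<close>. The chords whose component along \<open>v\<close> is at least
1 form a convex set that contains \<open>p\<close>. If it contains a chord longer than 1, then that chord is also connected to the
supporting pairs in nearby grid directions. Otherwise \<open>p\<close> is its only element, and then the supporting pairs in
directions near \<open>v\<close> are near \<open>p\<close>, so that an infinite concatenation of paths over shrinking
neighbourhoods of \<open>v\<close> leads to \<open>p\<close>.\<close>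

section \<open>Average increments of gradients of convex functions\<close>

text \<open>A discrete version of the bound of the second derivative of a convex function by its trace. The
hypothesis says that \<open>y\<close> selects subgradients of the convex function \<open>h\<close>. An increment of \<open>y\<close> along \<open>e\<close>, in
an arbitrary component \<open>f\<close>, is controlled by increments of \<open>y \<bullet> e\<close> along \<open>e\<close> and of \<open>y \<bullet> f\<close> along
\<open>f\<close>. The latter are nonnegative, so that no absolute values are needed and their averages over \<open>q\<close>
can be computed by shifting.\<close>

lemma gradient_increment_bound:
  fixes h :: "'a::real_inner \<Rightarrow> real" and y :: "'a \<Rightarrow> 'a"
  assumes sub: "\<And>z q. h q + y q \<bullet> (z - q) \<le> h z" and "\<delta> > 0"
  shows "\<bar>(y (q + \<delta> *\<^sub>R e) - y q) \<bullet> f\<bar>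
     \<le> (y (q + (2*\<delta>) *\<^sub>R e) - y q) \<bullet> e + (y (q + (2*\<delta>) *\<^sub>R f) - y (q + (-2*\<delta>) *\<^sub>R f)) \<bullet> f"
proof -
  have mono: "(y a - y b) \<bullet> (a - b) \<ge> 0" for a b
    using sub[of a b] sub[of b a] by (simp add: inner_simps)
  have one_sided: "(y (q + \<delta> *\<^sub>R e) - y q) \<bullet> f
      \<le> (y (q + (2*\<delta>) *\<^sub>R e) - y q) \<bullet> e + (y (q + (2*\<delta>) *\<^sub>R f) - y q) \<bullet> f" for f
  proof -
    \<comment> \<open>The point \<open>u\<close> is the midpoint of \<open>z1\<close> and \<open>z2\<close>: subtract the supporting affine function
    at \<open>q\<close> from \<open>h\<close>, bound it at \<open>u\<close> from below through \<open>p\<close>, from above by midpoint convexity.\<close>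
    define p u z1 z2 where "p = q + \<delta> *\<^sub>R e" and "u = q + \<delta> *\<^sub>R e + \<delta> *\<^sub>R f"
      and "z1 = q + (2*\<delta>) *\<^sub>R e" and "z2 = q + (2*\<delta>) *\<^sub>R f"
    have two: "(2*\<delta>) *\<^sub>R v = \<delta> *\<^sub>R v + \<delta> *\<^sub>R v" for v :: 'a
      by (metis mult_2 scaleR_add_left)
    have dirs: "u - p = \<delta> *\<^sub>R f" "p - q = \<delta> *\<^sub>R e" "z1 - u = \<delta> *\<^sub>R (e - f)" "z2 - u = - (\<delta> *\<^sub>R (e - f))"
      "q - z1 = - ((2*\<delta>) *\<^sub>R e)" "q - z2 = - ((2*\<delta>) *\<^sub>R f)"
      using two by (simp_all add: p_def u_def z1_def z2_def scaleR_diff_right)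
    have "h p + \<delta> * (y p \<bullet> f) \<le> h u" "h q + \<delta> * (y q \<bullet> e) \<le> h p"
      "2 * h u \<le> h z1 + h z2"
      "h z1 - 2 * \<delta> * (y z1 \<bullet> e) \<le> h q" "h z2 - 2 * \<delta> * (y z2 \<bullet> f) \<le> h q"
      using sub[of p u] sub[of q p] sub[of u z1] sub[of u z2] sub[of z1 q] sub[of z2 q]
      by (simp_all add: dirs)
    then have "\<delta> * (y p \<bullet> f + y q \<bullet> e) \<le> \<delta> * (y z1 \<bullet> e + y z2 \<bullet> f)"
      by (simp add: algebra_simps)
    then have "y p \<bullet> f + y q \<bullet> e \<le> y z1 \<bullet> e + y z2 \<bullet> f"
      using \<open>\<delta> > 0\<close> by simp
    then show ?thesis
      by (simp add: p_def z1_def z2_def inner_simps)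
  qed
  have "0 \<le> (2*\<delta>) * ((y (q + (2*\<delta>) *\<^sub>R f) - y q) \<bullet> f)"
    using mono[of "q + (2*\<delta>) *\<^sub>R f" q] by simp
  moreover have "0 \<le> (2*\<delta>) * ((y q - y (q + (-2*\<delta>) *\<^sub>R f)) \<bullet> f)"
    using mono[of q "q + (-2*\<delta>) *\<^sub>R f"] by simp
  ultimately have "0 \<le> (y (q + (2*\<delta>) *\<^sub>R f) - y q) \<bullet> f" "0 \<le> (y q - y (q + (-2*\<delta>) *\<^sub>R f)) \<bullet> f"
    using \<open>\<delta> > 0\<close> by (simp_all add: zero_le_mult_iff)
  then show ?thesis
    using one_sided[of f] one_sided[of "- f"] by (simp add: inner_simps abs_le_iff)
qed

lemma emeasure_cball_less_top: "emeasure lborel (cball (c::'a::euclidean_space) r) < top"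
  using emeasure_lborel_cball_finite[of c r] by (simp add: infinity_ennreal_def)

text \<open>The weight used for averaging over translations. It is compactly supported and Lipschitz, so that
shifting it by a small vector changes its integral against a bounded function only by a multiple
of the length of the shift.\<close>

definition cutoff :: "'a::real_normed_vector \<Rightarrow> real" where
  "cutoff s = max 0 (1 - norm s)"

lemma cutoff_nonneg [simp]: "cutoff s \<ge> 0"
  and cutoff_pos_iff: "cutoff s > 0 \<longleftrightarrow> norm s < 1"
  by (auto simp: cutoff_def)

lemma continuous_on_cutoff [continuous_intros]:
  "continuous_on S f \<Longrightarrow> continuous_on S (\<lambda>x. cutoff (f x))"
  unfolding cutoff_def by (intro continuous_intros)

lemma cutoff_difference:
  "\<bar>cutoff (s - a) - cutoff (s - b)\<bar> \<le> norm (a - b) * (indicator (cball a 1) s + indicator (cball b 1) s)"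
proof -
  have "\<bar>norm (s - a) - norm (s - b)\<bar> \<le> norm (a - b)"
    by (smt (verit, ccfv_threshold) dist_norm dist_triangle norm_minus_commute)
  then have "\<bar>cutoff (s - a) - cutoff (s - b)\<bar> \<le> norm (a - b)"
    unfolding cutoff_def by linarith
  moreover have "cutoff (s - c) = 0" if "s \<notin> cball c 1" for c
    using that by (simp add: cutoff_def dist_norm norm_minus_commute)
  ultimately show ?thesis
    by (auto simp: indicator_def)
qed

lemma integrable_cutoff_times:
  fixes g :: "'a::euclidean_space \<Rightarrow> real" and B :: real
  assumes "continuous_on UNIV g" and "\<And>x. \<bar>g x\<bar> \<le> B"
  shows "integrable lborel (\<lambda>s. cutoff (s - a) * g s)"
proof (rule Bochner_Integration.integrable_bound)
  show "integrable lborel (\<lambda>s. B * indicator (cball a 1) s :: real)"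
    by (intro integrable_mult_right integrable_real_indicator) (auto simp: emeasure_cball_less_top)
  show "(\<lambda>s. cutoff (s - a) * g s) \<in> borel_measurable lborel"
    using assms(1) by (auto intro!: borel_measurable_continuous_onI continuous_intros)
  have "\<bar>cutoff (s - a) * g s\<bar> \<le> \<bar>B * indicator (cball a 1) s\<bar>" for s
  proof (cases "s \<in> cball a 1")
    case True
    have "\<bar>cutoff (s - a)\<bar> \<le> 1" by (simp add: cutoff_def)
    then have "\<bar>cutoff (s - a)\<bar> * \<bar>g s\<bar> \<le> 1 * B"
      by (intro mult_mono assms(2)) auto
    then show ?thesis using True by (simp add: abs_mult)
  next
    case False
    then show ?thesis by (simp add: cutoff_def dist_norm norm_minus_commute)
  qed
  then show "AE s in lborel. norm (cutoff (s - a) * g s) \<le> norm (B * indicator (cball a 1) s)"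
    by (intro AE_I2) simp
qed

lemma integral_cutoff_shift:
  fixes g :: "'a::euclidean_space \<Rightarrow> real" and B :: real
  assumes "continuous_on UNIV g" and "\<And>x. \<bar>g x\<bar> \<le> B"
  shows "integrable lborel (\<lambda>s. cutoff s * g (s + a))"
    and "(\<integral>s. cutoff s * g (s + a) \<partial>lborel) = (\<integral>s. cutoff (s - a) * g s \<partial>lborel)"
proof -
  have cont: "continuous_on UNIV (\<lambda>s. cutoff (s - a) * g s)"
    using assms(1) by (intro continuous_intros)
  have "continuous_on UNIV (\<lambda>s. g (s + a))"
    by (intro continuous_on_compose2[OF assms(1)] continuous_intros) auto
  from integrable_cutoff_times[OF this, of B 0] assms(2)
  show "integrable lborel (\<lambda>s. cutoff s * g (s + a))" by simp
  have "(\<integral>s. cutoff (s - a) * g s \<partial>lborel) = (\<integral>s. cutoff (s - a) * g s \<partial>(distr lborel borel ((+) a)))"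
    by (simp add: lborel_distr_plus)
  also have "\<dots> = (\<integral>s. cutoff s * g (s + a) \<partial>lborel)"
    using cont by (subst integral_distr) (auto intro: borel_measurable_continuous_onI simp: add.commute)
  finally show "(\<integral>s. cutoff s * g (s + a) \<partial>lborel) = (\<integral>s. cutoff (s - a) * g s \<partial>lborel)" by simp
qed

lemma cutoff_shift_difference_bound:
  fixes g :: "'a::euclidean_space \<Rightarrow> real" and B :: real
  assumes g: "continuous_on UNIV g" "\<And>x. \<bar>g x\<bar> \<le> B"
  shows "integrable lborel (\<lambda>s. cutoff s * (g (s + a) - g (s + b)))"
    and "(\<integral>s. cutoff s * (g (s + a) - g (s + b)) \<partial>lborel)
      \<le> 2 * B * measure lborel (cball (0::'a) 1) * norm (a - b)"
proof -
  note I = integral_cutoff_shift[OF g]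
  show "integrable lborel (\<lambda>s. cutoff s * (g (s + a) - g (s + b)))"
    using Bochner_Integration.integrable_diff[OF I(1)[of a] I(1)[of b]] by (simp add: algebra_simps)
  have "B \<ge> 0" using g(2)[of 0] by simp
  have meas: "measure lborel (cball c 1) = measure lborel (cball (0::'a) 1)" for c :: 'a
  proof -
    have "measure lborel (cball c 1) = measure lebesgue (cball c 1)" by (simp add: measure_completion)
    also have "\<dots> = measure lebesgue (cball (0::'a) 1)"
      using measure_translation[of c "cball (0::'a) 1"] by (simp flip: cball_translation[of c 0 1])
    finally show ?thesis by (simp add: measure_completion)
  qed
  have "(\<integral>s. cutoff s * (g (s + a) - g (s + b)) \<partial>lborel)
      = (\<integral>s. cutoff s * g (s + a) - cutoff s * g (s + b) \<partial>lborel)"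
    by (simp add: algebra_simps)
  also have "\<dots> = (\<integral>s. cutoff (s - a) * g s \<partial>lborel) - (\<integral>s. cutoff (s - b) * g s \<partial>lborel)"
    by (subst Bochner_Integration.integral_diff) (simp_all add: I)
  also have "\<dots> = (\<integral>s. cutoff (s - a) * g s - cutoff (s - b) * g s \<partial>lborel)"
    by (subst Bochner_Integration.integral_diff) (simp_all add: integrable_cutoff_times[OF g])
  also have "\<dots> \<le> (\<integral>s. B * norm (a - b) * (indicator (cball a 1) s + indicator (cball b 1) s) \<partial>lborel)"
  proof (rule integral_mono)
    show "integrable lborel (\<lambda>s. cutoff (s - a) * g s - cutoff (s - b) * g s)"
      by (intro Bochner_Integration.integrable_diff integrable_cutoff_times[OF g])
    show "integrable lborel (\<lambda>s. B * norm (a - b) * (indicator (cball a 1) s + indicator (cball b 1) s) :: real)"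
      by (intro integrable_mult_right Bochner_Integration.integrable_add integrable_real_indicator)
         (auto simp: emeasure_cball_less_top)
    fix s :: 'a
    have "cutoff (s - a) * g s - cutoff (s - b) * g s = (cutoff (s - a) - cutoff (s - b)) * g s"
      by (simp add: algebra_simps)
    also have "\<dots> \<le> \<bar>cutoff (s - a) - cutoff (s - b)\<bar> * \<bar>g s\<bar>"
      by (metis abs_ge_self abs_mult)
    also have "\<dots> \<le> (norm (a - b) * (indicator (cball a 1) s + indicator (cball b 1) s)) * B"
      by (intro mult_mono cutoff_difference g(2)) (auto simp: indicator_def)
    finally show "cutoff (s - a) * g s - cutoff (s - b) * g s
      \<le> B * norm (a - b) * (indicator (cball a 1) s + indicator (cball b 1) s)"
      by (simp add: mult_ac)
  qed
  also have "\<dots> = B * norm (a - b) * (measure lborel (cball a 1) + measure lborel (cball b 1))"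
    by (subst Bochner_Integration.integral_mult_right_zero, subst Bochner_Integration.integral_add)
       (auto simp: emeasure_cball_less_top)
  finally show "(\<integral>s. cutoff s * (g (s + a) - g (s + b)) \<partial>lborel)
      \<le> 2 * B * measure lborel (cball (0::'a) 1) * norm (a - b)"
    by (simp add: meas[of a] meas[of b] mult_ac)
qed

text \<open>On average over the base point, a bounded gradient changes by at most a constant times \<open>\<delta>\<close> over a
step of length \<open>\<delta>\<close>. The constant depends on the gradient only through its bound, which makes the
estimate uniform in the regularisation used later.\<close>

lemma average_gradient_increment:
  fixes h :: "'a::euclidean_space \<Rightarrow> real" and y :: "'a \<Rightarrow> 'a" and B \<delta> :: real
  assumes sub: "\<And>z q. h q + y q \<bullet> (z - q) \<le> h z" and "\<delta> > 0" and e: "e \<in> Basis"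
    and cont: "continuous_on UNIV y" and B: "\<And>x. norm (y x) \<le> (B::real)"
  shows "integrable lborel (\<lambda>s. cutoff s * norm (y (s + a + \<delta> *\<^sub>R e) - y (s + a)))"
    and "(\<integral>s. cutoff s * norm (y (s + a + \<delta> *\<^sub>R e) - y (s + a)) \<partial>lborel)
      \<le> 12 * DIM('a) * B * measure lborel (cball (0::'a) 1) * \<delta>"
proof -
  have g: "continuous_on UNIV (\<lambda>x. y x \<bullet> f)" "\<bar>y x \<bullet> f\<bar> \<le> B" if "f \<in> Basis" for f x
    using cont order_trans[OF Basis_le_norm[OF that] B] by (auto intro!: continuous_intros)
  let ?m = "measure lborel (cball (0::'a) 1)"
  have "continuous_on UNIV (\<lambda>s. norm (y (s + \<delta> *\<^sub>R e) - y s))"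
    by (intro continuous_intros cont continuous_on_compose2[OF cont]) auto
  moreover have "\<bar>norm (y (s + \<delta> *\<^sub>R e) - y s)\<bar> \<le> 2 * B" for s
    using norm_triangle_ineq4[of "y (s + \<delta> *\<^sub>R e)" "y s"] B[of s] B[of "s + \<delta> *\<^sub>R e"] by simp
  ultimately show int: "integrable lborel (\<lambda>s. cutoff s * norm (y (s + a + \<delta> *\<^sub>R e) - y (s + a)))"
    by (rule integral_cutoff_shift(1))
  \<comment> \<open>The summand for \<open>f\<close> of the upper bound given by the increment inequality.\<close>
  define R where "R f s = cutoff s * ((y (s + (a + (2*\<delta>) *\<^sub>R e)) \<bullet> e) - y (s + a) \<bullet> e)
     + cutoff s * ((y (s + (a + (2*\<delta>) *\<^sub>R f)) \<bullet> f) - y (s + (a + (-2*\<delta>) *\<^sub>R f)) \<bullet> f)" for f s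
  have R: "integrable lborel (R f)" "(\<integral>s. R f s \<partial>lborel) \<le> 12 * B * ?m * \<delta>" if f: "f \<in> Basis" for f
  proof -
    note 1 = cutoff_shift_difference_bound[OF g[OF e]] and 2 = cutoff_shift_difference_bound[OF g[OF f]]
    show "integrable lborel (R f)"
      unfolding R_def by (intro Bochner_Integration.integrable_add 1 2)
    have "(\<integral>s. R f s \<partial>lborel) \<le> 2 * B * ?m * norm ((a + (2*\<delta>) *\<^sub>R e) - a)
        + 2 * B * ?m * norm ((a + (2*\<delta>) *\<^sub>R f) - (a + (-2*\<delta>) *\<^sub>R f))"
      unfolding R_def by (subst Bochner_Integration.integral_add[OF 1(1) 2(1)]) (intro add_mono 1 2)
    also have "(a + (2*\<delta>) *\<^sub>R f) - (a + (-2*\<delta>) *\<^sub>R f) = (4*\<delta>) *\<^sub>R f"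
      by (simp add: algebra_simps flip: scaleR_add_left)
    finally show "(\<integral>s. R f s \<partial>lborel) \<le> 12 * B * ?m * \<delta>"
      using \<open>\<delta> > 0\<close> e f by (simp add: mult_ac)
  qed
  have "(\<integral>s. cutoff s * norm (y (s + a + \<delta> *\<^sub>R e) - y (s + a)) \<partial>lborel)
      \<le> (\<integral>s. (\<Sum>f\<in>Basis. R f s) \<partial>lborel)"
  proof (rule integral_mono[OF int])
    show "integrable lborel (\<lambda>s. \<Sum>f\<in>Basis. R f s)"
      using R(1) by (intro Bochner_Integration.integrable_sum) auto
    fix s
    have "norm (y (s + a + \<delta> *\<^sub>R e) - y (s + a)) \<le> (\<Sum>f\<in>Basis. \<bar>(y (s + a + \<delta> *\<^sub>R e) - y (s + a)) \<bullet> f\<bar>)"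
      by (rule norm_le_l1)
    also have "\<dots> \<le> (\<Sum>f\<in>Basis. (y (s + a + (2*\<delta>) *\<^sub>R e) - y (s + a)) \<bullet> e
      + (y (s + a + (2*\<delta>) *\<^sub>R f) - y (s + a + (-2*\<delta>) *\<^sub>R f)) \<bullet> f)"
      by (intro sum_mono gradient_increment_bound[OF sub \<open>\<delta> > 0\<close>])
    finally have "cutoff s * norm (y (s + a + \<delta> *\<^sub>R e) - y (s + a))
       \<le> cutoff s * (\<Sum>f\<in>Basis. (y (s + a + (2*\<delta>) *\<^sub>R e) - y (s + a)) \<bullet> e
      + (y (s + a + (2*\<delta>) *\<^sub>R f) - y (s + a + (-2*\<delta>) *\<^sub>R f)) \<bullet> f)"
      by (intro mult_left_mono) auto
    also have "\<dots> = (\<Sum>f\<in>Basis. R f s)"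
      unfolding R_def sum_distrib_left by (intro sum.cong refl) (simp add: inner_diff_left distrib_left right_diff_distrib add.assoc[of s a] add_diff_eq)
    finally show "cutoff s * norm (y (s + a + \<delta> *\<^sub>R e) - y (s + a)) \<le> (\<Sum>f\<in>Basis. R f s)" .
  qed
  also have "\<dots> = (\<Sum>f\<in>Basis. (\<integral>s. R f s \<partial>lborel))"
    using R(1) by (intro Bochner_Integration.integral_sum) auto
  also have "\<dots> \<le> (\<Sum>f\<in>(Basis::'a set). 12 * B * ?m * \<delta>)"
    by (intro sum_mono R(2))
  finally show "(\<integral>s. cutoff s * norm (y (s + a + \<delta> *\<^sub>R e) - y (s + a)) \<partial>lborel)
      \<le> 12 * DIM('a) * B * ?m * \<delta>"
    by (simp add: mult_ac)
qed

text \<open>A consequence of Fatou's lemma.\<close>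

lemma AE_bounded_infinitely_often:
  fixes F :: "nat \<Rightarrow> 'a \<Rightarrow> real"
  assumes int: "\<And>n. integrable M (F n)" and nonneg: "\<And>n s. F n s \<ge> 0"
    and bound: "\<And>n. (\<integral>s. F n s \<partial>M) \<le> C"
  shows "AE s in M. \<exists>L. \<exists>\<^sub>F n in sequentially. F n s \<le> L"
proof -
  have [measurable]: "F n \<in> borel_measurable M" for n using int by auto
  have "(\<integral>\<^sup>+s. liminf (\<lambda>n. ennreal (F n s)) \<partial>M) \<le> liminf (\<lambda>n. \<integral>\<^sup>+s. ennreal (F n s) \<partial>M)"
    by (rule nn_integral_liminf) auto
  also have "\<dots> \<le> liminf (\<lambda>n::nat. ennreal C)"
    by (intro Liminf_mono always_eventually allI)
       (use int nonneg bound in \<open>simp add: nn_integral_eq_integral ennreal_leI\<close>)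
  also have "\<dots> < \<infinity>" by (simp add: Liminf_const)
  finally have "AE s in M. liminf (\<lambda>n. ennreal (F n s)) \<noteq> \<infinity>"
    by (intro nn_integral_PInf_AE) auto
  then show ?thesis
  proof (rule AE_mp, intro AE_I2 impI)
    fix s assume "liminf (\<lambda>n. ennreal (F n s)) \<noteq> \<infinity>"
    then obtain L where L: "liminf (\<lambda>n. ennreal (F n s)) = ennreal L" "L \<ge> 0"
      by (metis ennreal_cases infinity_ennreal_def)
    have "\<exists>\<^sub>F n in sequentially. F n s \<le> L + 1"
    proof (rule ccontr)
      assume "\<not> ?thesis"
      then have "\<forall>\<^sub>F n in sequentially. ennreal (L + 1) \<le> ennreal (F n s)"
        unfolding not_frequently by eventually_elim (simp add: ennreal_leI)
      then have "ennreal (L + 1) \<le> liminf (\<lambda>n. ennreal (F n s))"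
        by (rule Liminf_bounded)
      then show False using L by simp
    qed
    then show "\<exists>L. \<exists>\<^sub>F n in sequentially. F n s \<le> L" ..
  qed
qed

section \<open>Limits and concatenations of paths\<close>

text \<open>The polygonal path through \<open>p 0, \<dots>, p N\<close>, parametrised by arc length and constant once the end
is reached.\<close>

lemma polygonal_chain_unit_speed:
  fixes p :: "nat \<Rightarrow> 'b::real_normed_vector"
  shows "\<exists>g. g 0 = p 0 \<and> (\<forall>t. (\<Sum>k<N. norm (p (Suc k) - p k)) \<le> t \<longrightarrow> g t = p N)
    \<and> (\<forall>s t. 0 \<le> s \<and> s \<le> t \<longrightarrow> norm (g t - g s) \<le> t - s)
    \<and> (\<forall>t\<ge>0. g t = p 0 \<or> (\<exists>k<N. g t \<in> closed_segment (p k) (p (Suc k))))"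
proof (induction N)
  case 0
  show ?case by (intro exI[of _ "\<lambda>_. p 0"]) auto
next
  case (Suc N)
  define l where "l = (\<Sum>k<N. norm (p (Suc k) - p k))"
  define d where "d = norm (p (Suc N) - p N)"
  have "l \<ge> 0" "d \<ge> 0" by (simp_all add: l_def d_def sum_nonneg)
  obtain g where g: "g 0 = p 0" "\<And>t. l \<le> t \<Longrightarrow> g t = p N"
      "\<And>s t. 0 \<le> s \<Longrightarrow> s \<le> t \<Longrightarrow> norm (g t - g s) \<le> t - s"
      "\<And>t. t \<ge> 0 \<Longrightarrow> g t = p 0 \<or> (\<exists>k<N. g t \<in> closed_segment (p k) (p (Suc k)))"
    using Suc.IH unfolding l_def by blast
  define f where "f t = (if t \<le> l then g t else p N + (min (t - l) d / d) *\<^sub>R (p (Suc N) - p N))" for t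
  have left: "f t = g t" if "t \<le> l" for t using that by (simp add: f_def)
  have right: "f t = p N + (min (t - l) d / d) *\<^sub>R (p (Suc N) - p N)" if "t \<ge> l" for t
    using that \<open>d \<ge> 0\<close> g(2)[of t] by (auto simp: f_def)
  have lip_left: "norm (f t - f s) \<le> t - s" if "0 \<le> s" "s \<le> t" "t \<le> l" for s t
    using that g(3)[of s t] by (simp add: left)
  have lip_right: "norm (f t - f s) \<le> t - s" if "l \<le> s" "s \<le> t" for s t
  proof (cases "d = 0")
    case True
    then show ?thesis using that by (simp add: right)
  next
    case False
    have "f t - f s = ((min (t - l) d - min (s - l) d) / d) *\<^sub>R (p (Suc N) - p N)"
      using that by (simp add: right diff_divide_distrib scaleR_diff_left)
    then have "norm (f t - f s) = \<bar>min (t - l) d - min (s - l) d\<bar>"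
      using False \<open>d \<ge> 0\<close> by (simp flip: d_def)
    then show ?thesis using that by linarith
  qed
  have lip: "norm (f t - f s) \<le> t - s" if "0 \<le> s" "s \<le> t" for s t
  proof -
    consider "t \<le> l" | "l \<le> s" | "s \<le> l" "l \<le> t" by linarith
    then show ?thesis
    proof cases
      case 3
      have "norm (f t - f s) \<le> norm (f t - f l) + norm (f l - f s)"
        using norm_triangle_ineq[of "f t - f l" "f l - f s"] by simp
      then show ?thesis using lip_right[of l t] lip_left[of s l] 3 that by simp
    qed (use lip_left lip_right that in auto)
  qed
  have "f t = p (Suc N)" if "(\<Sum>k<Suc N. norm (p (Suc k) - p k)) \<le> t" for t
  proof -
    have "d \<le> t - l" using that by (simp add: l_def d_def)
    then have "f t = p N + (d / d) *\<^sub>R (p (Suc N) - p N)"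
      using \<open>d \<ge> 0\<close> right[of t] by (simp add: min_absorb2)
    moreover have "p (Suc N) = p N" if "d = 0" using that by (simp add: d_def)
    ultimately show ?thesis by (cases "d = 0") simp_all
  qed
  moreover have "f t = p 0 \<or> (\<exists>k<Suc N. f t \<in> closed_segment (p k) (p (Suc k)))" if "t \<ge> 0" for t
  proof (cases "t \<le> l")
    case True
    then show ?thesis using g(4)[OF that] by (auto simp: left less_Suc_eq)
  next
    case False
    have "f t \<in> closed_segment (p N) (p (Suc N))"
      unfolding in_segment
      by (rule exI[of _ "min (t - l) d / d"])
         (use False \<open>d \<ge> 0\<close> in \<open>auto simp: right algebra_simps divide_le_eq_1\<close>)
    then show ?thesis by blast
  qed
  ultimately show ?case
    using g(1) left[of 0] \<open>l \<ge> 0\<close> lip by (intro exI[of _ f]) auto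
qed

lemma polygonal_chain_lipschitz:
  fixes p :: "nat \<Rightarrow> 'b::real_normed_vector"
  assumes "(\<Sum>k<N. norm (p (Suc k) - p k)) \<le> L" and "N > 0"
  obtains g where "g 0 = p 0" "g 1 = p N"
    "\<And>s t. s \<in> {0..1} \<Longrightarrow> t \<in> {0..1} \<Longrightarrow> norm (g t - g s) \<le> L * \<bar>t - s\<bar>"
    "\<And>t. t \<in> {0..1} \<Longrightarrow> \<exists>k<N. g t \<in> closed_segment (p k) (p (Suc k))"
proof -
  obtain g where g: "g 0 = p 0" "\<And>t. (\<Sum>k<N. norm (p (Suc k) - p k)) \<le> t \<Longrightarrow> g t = p N"
      "\<And>s t. 0 \<le> s \<Longrightarrow> s \<le> t \<Longrightarrow> norm (g t - g s) \<le> t - s"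
      "\<And>t. t \<ge> 0 \<Longrightarrow> g t = p 0 \<or> (\<exists>k<N. g t \<in> closed_segment (p k) (p (Suc k)))"
    using polygonal_chain_unit_speed[of p N] by blast
  have "L \<ge> 0" using assms(1) by (meson norm_ge_zero order_trans sum_nonneg)
  show ?thesis
  proof
    show "g (L * 0) = p 0" "g (L * 1) = p N" using g(1,2) assms by simp_all
    show "norm (g (L * t) - g (L * s)) \<le> L * \<bar>t - s\<bar>" if "s \<in> {0..1}" "t \<in> {0..1}" for s t
    proof (cases "s \<le> t")
      case True
      then show ?thesis
        using g(3)[of "L * s" "L * t"] that \<open>L \<ge> 0\<close> by (simp add: mult_left_mono right_diff_distrib)
    next
      case False
      then show ?thesis
        using g(3)[of "L * t" "L * s"] that \<open>L \<ge> 0\<close>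
        by (simp add: mult_left_mono right_diff_distrib norm_minus_commute)
    qed
    show "\<exists>k<N. g (L * t) \<in> closed_segment (p k) (p (Suc k))" if "t \<in> {0..1}" for t
      using g(4)[of "L * t"] that \<open>L \<ge> 0\<close> \<open>N > 0\<close> ends_in_segment(1)[of "p 0" "p (Suc 0)"] by auto
  qed
qed

text \<open>Infinitely many chains of uniformly bounded length, whose segments lie in decreasing closed sets
\<open>A n\<close>, have by Arzela and Ascoli a limit path, which lies in all of these sets. The sets \<open>B\<close> and \<open>C\<close>
carry the information about the ends.\<close>

lemma chains_limit_path:
  fixes p :: "nat \<Rightarrow> nat \<Rightarrow> 'b::euclidean_space"
  assumes freq: "\<exists>\<^sub>F n in sequentially. (\<Sum>k<N n. norm (p n (Suc k) - p n k)) \<le> L"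
    and N: "\<And>n. N n > 0"
    and seg: "\<And>n k. k < N n \<Longrightarrow> closed_segment (p n k) (p n (Suc k)) \<subseteq> A n"
    and A: "\<And>n. closed (A n)" "\<And>m n. m \<le> n \<Longrightarrow> A n \<subseteq> A m" and bdd: "bounded (A 0)"
    and B: "closed B" "\<And>n. p n 0 \<in> B" and C: "closed C" "\<And>n. p n (N n) \<in> C"
  obtains g where "path g" "\<And>n. path_image g \<subseteq> A n" "pathstart g \<in> B" "pathfinish g \<in> C"
proof -
  have "infinite {n. (\<Sum>k<N n. norm (p n (Suc k) - p n k)) \<le> L}"
    using freq by (simp add: cofinite_eq_sequentially frequently_cofinite[symmetric])
  from infinite_enumerate[OF this] obtain r :: "nat \<Rightarrow> nat" where r: "strict_mono r"
      "\<And>n. (\<Sum>k<N (r n). norm (p (r n) (Suc k) - p (r n) k)) \<le> L"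
    by auto
  have "\<exists>g. g 0 = p (r n) 0 \<and> g 1 = p (r n) (N (r n))
     \<and> (\<forall>s\<in>{0..1}. \<forall>t\<in>{0..1}. norm (g t - g s) \<le> L * \<bar>t - s\<bar>) \<and> (\<forall>t\<in>{0..1}. g t \<in> A (r n))" for n
  proof -
    obtain g where "g 0 = p (r n) 0" "g 1 = p (r n) (N (r n))"
      "\<And>s t. s \<in> {0..1} \<Longrightarrow> t \<in> {0..1} \<Longrightarrow> norm (g t - g s) \<le> L * \<bar>t - s\<bar>"
      "\<And>t. t \<in> {0..1} \<Longrightarrow> \<exists>k<N (r n). g t \<in> closed_segment (p (r n) k) (p (r n) (Suc k))"
      using polygonal_chain_lipschitz[OF r(2) N, of n] by blast
    then show ?thesis using seg[of _ "r n"] by (intro exI[of _ g]) blast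
  qed
  then obtain G where G: "\<And>n. G n 0 = p (r n) 0" "\<And>n. G n 1 = p (r n) (N (r n))"
      "\<And>n s t. s \<in> {0..1} \<Longrightarrow> t \<in> {0..1} \<Longrightarrow> norm (G n t - G n s) \<le> L * \<bar>t - s\<bar>"
      "\<And>n t. t \<in> {0..1::real} \<Longrightarrow> G n t \<in> A (r n)"
    by metis
  obtain M where M: "\<And>x. x \<in> A 0 \<Longrightarrow> norm x \<le> M" using bdd by (auto simp: bounded_iff)
  have "L \<ge> 0" using r(2)[of 0] by (meson norm_ge_zero order_trans sum_nonneg)
  obtain g k where g: "continuous_on {0..1} g" "strict_mono (k :: nat \<Rightarrow> nat)"
      "\<And>e. 0 < e \<Longrightarrow> \<exists>N. \<forall>n x. n \<ge> N \<and> x \<in> {0..1} \<longrightarrow> norm (G (k n) x - g x) < e"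
  proof (rule Arzela_Ascoli[of "{0..1::real}" G M])
    show "norm (G n t) \<le> M" if "t \<in> {0..1}" for n t
      using G(4)[OF that, of n] A(2)[of 0 "r n"] M by auto
    show "\<exists>d>0. \<forall>n t. t \<in> {0..1} \<and> norm (s - t) < d \<longrightarrow> norm (G n s - G n t) < e"
      if "s \<in> {0..1}" "0 < e" for s e
    proof (intro exI[of _ "e / (L + 1)"] conjI allI impI)
      show "e / (L + 1) > 0" using that \<open>L \<ge> 0\<close> by simp
      fix n t assume t: "t \<in> {0..1} \<and> norm (s - t) < e / (L + 1)"
      have "norm (G n s - G n t) \<le> L * \<bar>s - t\<bar>" using G(3) t that by blast
      also have "\<dots> \<le> (L + 1) * \<bar>s - t\<bar>" by (simp add: distrib_right)
      also have "\<dots> < e" using t \<open>L \<ge> 0\<close> by (simp add: pos_less_divide_eq mult.commute)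
      finally show "norm (G n s - G n t) < e" .
    qed
  qed auto
  have lim: "(\<lambda>n. G (k n) t) \<longlonglongrightarrow> g t" if "t \<in> {0..1}" for t
    using g(3) that by (fastforce simp: LIMSEQ_iff)
  have "path_image g \<subseteq> A j" for j
  proof
    fix x assume "x \<in> path_image g"
    then obtain t where t: "t \<in> {0..1}" "x = g t" by (auto simp: path_image_def)
    have "\<forall>\<^sub>F n in sequentially. G (k n) t \<in> A j"
    proof (rule eventually_sequentiallyI[of j])
      fix n assume "j \<le> n"
      then have "j \<le> r (k n)" using seq_suble[OF r(1), of "k n"] seq_suble[OF g(2), of n] by linarith
      then show "G (k n) t \<in> A j" using G(4)[OF t(1), of "k n"] A(2) by blast
    qed
    from Lim_in_closed_set[OF A(1) this _ lim[OF t(1)]] show "x \<in> A j" by (simp add: t(2))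
  qed
  moreover have "g 0 \<in> B" using closed_sequentially[OF B(1) _ lim[of 0]] B(2) G(1) by simp
  moreover have "g 1 \<in> C" using closed_sequentially[OF C(1) _ lim[of 1]] C(2) G(2) by simp
  moreover have "path g" using g(1) by (simp add: path_def)
  ultimately show ?thesis using that by (simp add: pathstart_def pathfinish_def)
qed

text \<open>Infinitely many consecutive paths that shrink to the point \<open>x\<close> can be run through in finite time and
end in \<open>x\<close>.\<close>

lemma path_component_infinite_concatenation:
  fixes g :: "nat \<Rightarrow> real \<Rightarrow> 'b::banach"
  assumes g: "\<And>k. path (g k)" "\<And>k. path_image (g k) \<subseteq> S"
    and match: "\<And>k. pathfinish (g k) = pathstart (g (Suc k))" and "closed S"
    and shrink: "\<And>r. r > 0 \<Longrightarrow> \<exists>k0. \<forall>k\<ge>k0. path_image (g k) \<subseteq> ball x r"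
  shows "path_component S (pathstart (g 0)) x"
proof -
  \<comment> \<open>The \<open>k\<close>-th path is run through in the time interval from \<open>a k\<close> to \<open>a (Suc k)\<close>.\<close>
  define a where "a k = real k / real (Suc k)" for k
  have a: "a 0 = 0" "a k \<ge> 0" "a k < 1" "a k < a (Suc k)" for k
    by (simp_all add: a_def field_simps)
  define c where "c k t = max 0 (min 1 ((t - a k) / (a (Suc k) - a k)))" for k t
  have c_low: "c k t = 0" if "t \<le> a k" for k t
    using that a(4)[of k] by (simp add: c_def divide_le_0_iff)
  have c_high: "c k t = 1" if "t \<ge> a (Suc k)" for k t
    using that a(4)[of k] by (simp add: c_def le_divide_eq_1)
  have c_in: "c k t \<in> {0..1}" for k t by (auto simp: c_def)
  have g_in: "g k s \<in> path_image (g k)" if "s \<in> {0..1}" for k s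
    using that by (auto simp: path_image_def)
  \<comment> \<open>\<open>F n\<close> follows the first \<open>n\<close> paths and then rests. Writing it as a telescoping sum makes
    its continuity immediate.\<close>
  define F where "F n t = pathstart (g 0) + (\<Sum>k<n. g k (c k t) - g k 0)" for n t
  have F_Suc: "F (Suc n) t = F n t + (g n (c n t) - g n 0)" for n t by (simp add: F_def)
  have F_late: "F n t = pathstart (g n)" if "t \<ge> a n" for n t
    using that
  proof (induction n)
    case 0 then show ?case by (simp add: F_def)
  next
    case (Suc n)
    then have "F n t = pathstart (g n)" using a(4)[of n] by simp
    then show ?case using match[of n] c_high[OF Suc.prems]
      by (simp add: F_Suc pathstart_def pathfinish_def)
  qed
  have F_step: "F (Suc n) t = (if t \<le> a n then F n t else g n (c n t))" for n t
    using F_late[of n t] by (auto simp: F_Suc c_low pathstart_def)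
  have F_in: "F n t \<in> S" for n t
  proof (induction n)
    case 0
    then show ?case using g(2)[of 0] pathstart_in_path_image[of "g 0"] by (auto simp: F_def)
  next
    case (Suc n)
    then show ?case using g(2)[of n] g_in[OF c_in, of n n t] by (auto simp: F_step)
  qed
  have F_cont: "continuous_on UNIV (F n)" for n
  proof -
    have "continuous_on {0..1} (g k)" for k using g(1) by (simp add: path_def)
    moreover have "continuous_on UNIV (c k)" for k
      unfolding c_def using a(4)[of k] by (intro continuous_intros) auto
    ultimately have "continuous_on UNIV (\<lambda>t. g k (c k t))" for k
      using c_in by (intro continuous_on_compose2[where g = "g k" and f = "c k"]) auto
    then show ?thesis unfolding F_def by (intro continuous_intros)
  qed
  have "uniformly_Cauchy_on {0..1} F"
    unfolding uniformly_Cauchy_on_def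
  proof (intro allI impI)
    fix e :: real assume "e > 0"
    then obtain k0 where k0: "\<And>k. k \<ge> k0 \<Longrightarrow> path_image (g k) \<subseteq> ball x (e/4)"
      using shrink[of "e/4"] by auto
    have tail: "F n t = F k0 t \<or> F n t \<in> ball x (e/4) \<and> F k0 t \<in> ball x (e/4)" if "n \<ge> k0" for n t
      using that
    proof (induction n rule: dec_induct)
      case (step n)
      have "F k0 t \<in> ball x (e/4)" if "t > a n"
      proof -
        have "a k0 \<le> a n" using step.hyps(1) lift_Suc_mono_le[of a] a(4) less_imp_le by blast
        then have "F k0 t = pathstart (g k0)" using that by (intro F_late) simp
        then show ?thesis using k0[of k0] pathstart_in_path_image[of "g k0"] by auto
      qed
      moreover have "g n (c n t) \<in> ball x (e/4)"
        using k0[OF step.hyps(1)] g_in[OF c_in, of n n t] by blast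
      ultimately show ?case using step.IH by (auto simp: F_step)
    qed simp
    have "dist (F m t) (F n t) < e" if "m \<ge> k0" "n \<ge> k0" for m n t
    proof -
      have "dist (F i t) (F k0 t) < e/2" if "i \<ge> k0" for i
        using tail[OF that, of t] dist_triangle_half_l[of "F i t" x "e/2" "F k0 t"] \<open>e > 0\<close>
        by (auto simp: dist_commute)
      then show ?thesis using that dist_triangle_half_l[of "F m t" "F k0 t" e "F n t"] by blast
    qed
    then show "\<exists>M. \<forall>t\<in>{0..1}. \<forall>m\<ge>M. \<forall>n\<ge>M. dist (F m t) (F n t) < e" by blast
  qed
  then obtain f where f: "uniform_limit {0..1} F f sequentially"
    using Cauchy_uniformly_convergent uniformly_convergent_on_def by blast
  have f_cont: "continuous_on {0..1} f"
    by (rule uniform_limit_theorem[OF _ f]) (auto intro: always_eventually continuous_on_subset[OF F_cont])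
  have lim: "(\<lambda>n. F n t) \<longlonglongrightarrow> f t" if "t \<in> {0..1}" for t
    using f that by (rule tendsto_uniform_limitI)
  have "f t \<in> S" if "t \<in> {0..1}" for t
    using closed_sequentially[OF \<open>closed S\<close> _ lim[OF that]] F_in by simp
  moreover have "F n 0 = pathstart (g 0)" for n
    using a(2) by (simp add: F_def c_low)
  then have "f 0 = pathstart (g 0)"
    using lim[of 0] by (simp add: LIMSEQ_const_iff)
  moreover have "(\<lambda>n. F n 1) \<longlonglongrightarrow> x"
  proof -
    have F1: "F n 1 = pathstart (g n)" for n using a(3)[of n] by (intro F_late) simp
    show ?thesis
      unfolding F1
    proof (rule LIMSEQ_I)
      fix r :: real assume "r > 0"
      then obtain k0 where "\<And>k. k \<ge> k0 \<Longrightarrow> path_image (g k) \<subseteq> ball x r" using shrink by blast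
      then show "\<exists>no. \<forall>n\<ge>no. norm (pathstart (g n) - x) < r"
        using pathstart_in_path_image by (metis dist_commute dist_norm mem_ball subsetD)
    qed
  qed
  then have "f 1 = x" using lim[of 1] LIMSEQ_unique by fastforce
  ultimately show ?thesis
    unfolding path_component_def using f_cont
    by (intro exI[of _ f]) (auto simp: path_def path_image_def pathstart_def pathfinish_def)
qed

lemma path_component_convex_subset:
  fixes C :: "'a::real_normed_vector set"
  assumes "convex C" "x \<in> C" "y \<in> C" "C \<subseteq> S"
  shows "path_component S x y"
  using assms closed_segment_subset[of x C y] by (intro path_component_linepath) auto

lemma path_component_continuous_image:
  assumes "path_component S x y" "continuous_on S f" "f ` S \<subseteq> T"
  shows "path_component T (f x) (f y)"
proof -
  obtain g where g: "path g" "path_image g \<subseteq> S" "pathstart g = x" "pathfinish g = y"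
    using assms(1) by (auto simp: path_component_def)
  then have "path (f \<circ> g)" "path_image (f \<circ> g) \<subseteq> T"
    using assms continuous_on_subset
    by (blast intro: path_continuous_image) (use g assms in \<open>auto simp: path_image_compose\<close>)
  then show ?thesis
    unfolding path_component_def using g(3,4) by (auto simp: pathstart_compose pathfinish_compose)
qed

section \<open>Supporting pairs along a line of directions\<close>

text \<open>The maximiser over \<open>K\<close> of \<open>v \<bullet> y\<close> minus the small penalty \<open>(y \<bullet> y) / (2 (n + 1))\<close>. Completing the
square identifies it with the point of \<open>K\<close> closest to \<open>(n + 1) v\<close>. Unlike the maximiser of \<open>v \<bullet> y\<close>
it is unique and depends continuously on \<open>v\<close>.\<close>

definition regularised_maximiser :: "'a::euclidean_space set \<Rightarrow> nat \<Rightarrow> 'a \<Rightarrow> 'a" where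
  "regularised_maximiser K n v = closest_point K (real (Suc n) *\<^sub>R v)"

text \<open>The last claim says that the regularised maximiser is a subgradient of the regularised support
function \<open>h\<close>.\<close>

lemma regularised_maximiser:
  fixes K :: "'a::euclidean_space set" and n :: nat
  assumes K: "compact K" "convex K" "K \<noteq> {}"
  defines "y \<equiv> regularised_maximiser K n"
  defines "h \<equiv> \<lambda>v. v \<bullet> y v - (y v \<bullet> y v) / (2 * real (Suc n))"
  shows "y v \<in> K"
    and "continuous_on UNIV y"
    and "z \<in> K \<Longrightarrow> v \<bullet> z \<le> v \<bullet> y v + y v \<bullet> (z - y v) / real (Suc n)"
    and "h q + y q \<bullet> (w - q) \<le> h w"
proof -
  have cl: "closed K" using K(1) by (rule compact_imp_closed)
  show mem: "y v \<in> K" for v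
    unfolding y_def regularised_maximiser_def using closest_point_in_set[OF cl K(3)] .
  show "continuous_on UNIV y"
    unfolding y_def regularised_maximiser_def
    by (intro continuous_on_compose2[OF continuous_on_closest_point[OF K(2) cl K(3), of UNIV]]
        continuous_intros) auto
  show max: "v \<bullet> z \<le> v \<bullet> y v + y v \<bullet> (z - y v) / real (Suc n)" if "z \<in> K" for v z
  proof -
    have "(real (Suc n) *\<^sub>R v - y v) \<bullet> (z - y v) \<le> 0"
      unfolding y_def regularised_maximiser_def by (rule closest_point_dot[OF K(2) cl that])
    then have "real (Suc n) * (v \<bullet> z - v \<bullet> y v) \<le> y v \<bullet> (z - y v)"
      by (simp add: inner_diff_left inner_diff_right right_diff_distrib del: of_nat_Suc)
    then have "v \<bullet> z - v \<bullet> y v \<le> y v \<bullet> (z - y v) / real (Suc n)"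
      by (simp add: pos_le_divide_eq mult.commute del: of_nat_Suc)
    then show ?thesis by simp
  qed
  have "w \<bullet> y q \<le> w \<bullet> y w + y w \<bullet> (y q - y w) / real (Suc n)"
    by (rule max[OF mem])
  also have "y w \<bullet> (y q - y w) \<le> (y q \<bullet> y q - y w \<bullet> y w) / 2"
    using inner_ge_zero[of "y q - y w"] by (simp add: inner_diff_left inner_diff_right inner_commute)
  finally have "w \<bullet> y q \<le> w \<bullet> y w + (y q \<bullet> y q - y w \<bullet> y w) / 2 / real (Suc n)"
    by (simp add: divide_right_mono del: of_nat_Suc)
  then show "h q + y q \<bullet> (w - q) \<le> h w"
    by (simp add: h_def inner_diff_right inner_commute diff_divide_distrib del: of_nat_Suc)
qed

text \<open>The points with \<open>k \<le> n + 1\<close> divide the segment from \<open>r\<close> to \<open>r + d\<close> into \<open>n + 1\<close> equal parts; each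
division point \<open>v\<close> is recorded together with the regularised maximisers in the directions \<open>- v\<close>
and \<open>v\<close>.\<close>

definition regularised_chain :: "'a::euclidean_space set \<Rightarrow> 'a \<Rightarrow> 'a \<Rightarrow> nat \<Rightarrow> nat \<Rightarrow> 'a \<times> 'a \<times> 'a" where
  "regularised_chain K r d n k = (let v = r + (real k / real (Suc n)) *\<^sub>R d in
     (v, regularised_maximiser K n (- v), regularised_maximiser K n v))"

text \<open>For almost every translate, the chains along the segment have bounded length for infinitely many \<open>n\<close>.
The restriction to \<open>norm s < 1\<close> comes from the support of the weight \<open>cutoff\<close>.\<close>

lemma AE_bounded_chain_length:
  fixes K :: "'a::euclidean_space set" and c :: real
  assumes K: "compact K" "convex K" "K \<noteq> {}" and e: "e \<in> Basis" and "c > 0"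
  shows "AE s in lborel. norm s < 1 \<longrightarrow> (\<exists>L. \<exists>\<^sub>F n in sequentially.
     (\<Sum>k<Suc n. norm (regularised_chain K (s + \<rho>) (c *\<^sub>R e) n (Suc k)
                    - regularised_chain K (s + \<rho>) (c *\<^sub>R e) n k)) \<le> L)"
proof -
  obtain B where B: "\<And>x. x \<in> K \<Longrightarrow> norm x \<le> B"
    using compact_imp_bounded[OF K(1)] by (auto simp: bounded_iff)
  define D where "D = 12 * DIM('a) * B * measure lborel (cball (0::'a) 1)"
  define y where "y = regularised_maximiser K"
  define \<delta> where "\<delta> n = c / real (Suc n)" for n
  define a where "a n k = \<rho> + (real k * \<delta> n) *\<^sub>R e" for n k
  have \<delta>: "\<delta> n > 0" for n using \<open>c > 0\<close> by (simp add: \<delta>_def)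
  have a_Suc: "s + a n k + \<delta> n *\<^sub>R e = s + a n (Suc k)" for s n k
    by (simp add: a_def algebra_simps)
  define I1 I2 where "I1 n k s = cutoff s * norm (y n (s + a n (Suc k)) - y n (s + a n k))"
    and "I2 n k s = cutoff s * norm (y n (- (s + a n (Suc k))) - y n (- (s + a n k)))" for n k s
  note reg = regularised_maximiser[OF K, folded y_def]
  have yB: "norm (y n v) \<le> B" for n v using B reg(1) by blast
  have 1: "integrable lborel (I1 n k)" "(\<integral>s. I1 n k s \<partial>lborel) \<le> D * \<delta> n" for n k
    using average_gradient_increment[where y = "y n" and \<delta> = "\<delta> n" and a = "a n k", OF reg(4) \<delta> e reg(2) yB]
    unfolding I1_def D_def by (simp_all add: a_Suc)
  have 2: "integrable lborel (I2 n k)" "(\<integral>s. I2 n k s \<partial>lborel) \<le> D * \<delta> n" for n k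
  proof -
    \<comment> \<open>The map \<open>v \<mapsto> - y n (- v)\<close> is the gradient of the reflected function \<open>v \<mapsto> h (- v)\<close>.\<close>
    define h where "h v = v \<bullet> y n v - (y n v \<bullet> y n v) / (2 * real (Suc n))" for v
    have sub: "h (- q) + (- y n (- q)) \<bullet> (z - q) \<le> h (- z)" for z q
      using reg(4)[of "- q" n "- z"] by (simp add: h_def inner_diff_right)
    have cont: "continuous_on UNIV (\<lambda>v. - y n (- v))"
      by (intro continuous_intros continuous_on_compose2[OF reg(2)]) auto
    show "integrable lborel (I2 n k)" "(\<integral>s. I2 n k s \<partial>lborel) \<le> D * \<delta> n"
      using average_gradient_increment[where \<delta> = "\<delta> n" and a = "a n k", OF sub \<delta> e cont, of B] yB
      unfolding I2_def D_def by (simp_all add: a_Suc norm_minus_commute)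
  qed
  define F where "F n s = (\<Sum>k<Suc n. I1 n k s + I2 n k s)" for n s
  have "AE s in lborel. \<exists>L. \<exists>\<^sub>F n in sequentially. F n s \<le> L"
  proof (rule AE_bounded_infinitely_often)
    show "integrable lborel (F n)" for n
      unfolding F_def by (intro Bochner_Integration.integrable_sum Bochner_Integration.integrable_add 1 2)
    show "F n s \<ge> 0" for n s
      unfolding F_def I1_def I2_def by (intro sum_nonneg add_nonneg_nonneg mult_nonneg_nonneg) auto
    fix n
    have "(\<integral>s. F n s \<partial>lborel) = (\<Sum>k<Suc n. (\<integral>s. I1 n k s \<partial>lborel) + (\<integral>s. I2 n k s \<partial>lborel))"
      unfolding F_def Bochner_Integration.integral_add[OF 1(1) 2(1), symmetric]
      by (intro Bochner_Integration.integral_sum Bochner_Integration.integrable_add 1 2)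
    also have "\<dots> \<le> (\<Sum>k<Suc n. D * \<delta> n + D * \<delta> n)"
      by (intro sum_mono add_mono 1 2)
    also have "\<dots> = 2 * D * c"
      by (simp add: \<delta>_def field_simps del: sum.lessThan_Suc of_nat_Suc)
    finally show "(\<integral>s. F n s \<partial>lborel) \<le> 2 * D * c" .
  qed
  then show ?thesis
  proof (rule AE_mp, intro AE_I2 impI)
    fix s :: 'a assume "\<exists>L. \<exists>\<^sub>F n in sequentially. F n s \<le> L" and "norm s < 1"
    then obtain L where L: "\<exists>\<^sub>F n in sequentially. F n s \<le> L" by blast
    have pos: "cutoff s > 0" using \<open>norm s < 1\<close> by (simp add: cutoff_pos_iff)
    define P where "P = regularised_chain K (s + \<rho>) (c *\<^sub>R e)"
    have P: "P n k = (s + a n k, y n (- (s + a n k)), y n (s + a n k))" for n k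
      unfolding P_def regularised_chain_def Let_def a_def \<delta>_def y_def by (simp add: add.assoc)
    have "(\<Sum>k<Suc n. norm (P n (Suc k) - P n k)) \<le> c + L / cutoff s" if "F n s \<le> L" for n
    proof -
      have "norm (P n (Suc k) - P n k) \<le> \<delta> n + (I1 n k s + I2 n k s) / cutoff s" for k
      proof -
        have "norm (P n (Suc k) - P n k) \<le> norm ((s + a n (Suc k)) - (s + a n k))
            + (norm (y n (- (s + a n (Suc k))) - y n (- (s + a n k))) + norm (y n (s + a n (Suc k)) - y n (s + a n k)))"
          unfolding P diff_Pair by (intro order_trans[OF norm_Pair_le] add_left_mono norm_Pair_le)
        also have "(s + a n (Suc k)) - (s + a n k) = \<delta> n *\<^sub>R e"
          using a_Suc[of s n k] by (metis add_diff_cancel_left')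
        finally show ?thesis
          using pos e \<delta>[of n] by (simp add: I1_def I2_def add_divide_distrib)
      qed
      then have "(\<Sum>k<Suc n. norm (P n (Suc k) - P n k))
          \<le> (\<Sum>k<Suc n. \<delta> n + (I1 n k s + I2 n k s) / cutoff s)"
        by (intro sum_mono)
      also have "\<dots> = c + F n s / cutoff s"
        by (simp add: F_def \<delta>_def sum.distrib sum_divide_distrib add_divide_distrib
            del: sum.lessThan_Suc of_nat_Suc)
      also have "\<dots> \<le> c + L / cutoff s"
        using that pos by (simp add: divide_right_mono)
      finally show ?thesis .
    qed
    with L have "\<exists>\<^sub>F n in sequentially. (\<Sum>k<Suc n. norm (P n (Suc k) - P n k)) \<le> c + L / cutoff s"
      by (rule frequently_elim1)
    then show "\<exists>L. \<exists>\<^sub>F n in sequentially. (\<Sum>k<Suc n. norm (regularised_chain K (s + \<rho>) (c *\<^sub>R e) n (Suc k)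
                    - regularised_chain K (s + \<rho>) (c *\<^sub>R e) n k)) \<le> L"
      unfolding P_def by (rule exI)
  qed
qed

text \<open>The pairs of points of \<open>K\<close> on the two supporting hyperplanes orthogonal to \<open>v\<close>: the first point lies
on the lower one and the second on the upper one. For \<open>v = 0\<close> these are all pairs.\<close>

definition supporting_pairs :: "'a::euclidean_space set \<Rightarrow> 'a \<Rightarrow> ('a \<times> 'a) set" where
  "supporting_pairs K v = {(x, y). x \<in> K \<and> y \<in> K \<and> (\<forall>x'\<in>K. \<forall>y'\<in>K. v \<bullet> (y' - x') \<le> v \<bullet> (y - x))}"

text \<open>The graph over \<open>W\<close> of the set-valued map that sends \<open>v\<close> to its supporting pairs.\<close>

definition supporting_bundle :: "'a::euclidean_space set \<Rightarrow> 'a set \<Rightarrow> ('a \<times> 'a \<times> 'a) set" where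
  "supporting_bundle K W = {(v, p). v \<in> W \<and> p \<in> supporting_pairs K v}"

text \<open>Over a segment along which the regularised chains have bounded length, the supporting bundle contains
a path from one end to the other. A chain of index \<open>n\<close> lies, with the segments between its vertices,
in the set \<open>A n\<close> of pairs that are supporting up to an error of order \<open>1 / n\<close>.\<close>

lemma supporting_bundle_path_over_segment:
  fixes K :: "'a::euclidean_space set"
  assumes K: "compact K" "convex K" "K \<noteq> {}"
    and freq: "\<exists>\<^sub>F n in sequentially. 
     (\<Sum>k<Suc n. norm (regularised_chain K r d n (Suc k) - regularised_chain K r d n k)) \<le> L"
  obtains g where "path g" "path_image g \<subseteq> supporting_bundle K (closed_segment r (r + d))"
    "fst (pathstart g) = r" "fst (pathfinish g) = r + d"
proof -
  obtain B where B: "\<And>x. x \<in> K \<Longrightarrow> norm x \<le> B"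
    using compact_imp_bounded[OF K(1)] by (auto simp: bounded_iff)
  have "B \<ge> 0" using B K(3) by (meson all_not_in_conv norm_ge_zero order_trans)
  define \<eta> where "\<eta> n = (4 * B * B + 4 * B * norm d) / real (Suc n)" for n
  define A where "A n = {(v, x, y). v \<in> closed_segment r (r + d) \<and> x \<in> K \<and> y \<in> K \<and>
     (\<forall>x'\<in>K. \<forall>y'\<in>K. v \<bullet> (y' - x') \<le> v \<bullet> (y - x) + \<eta> n)}" for n
  define y where "y = regularised_maximiser K"
  define p where "p = regularised_chain K r d"
  define v where "v n k = r + (real k / real (Suc n)) *\<^sub>R d" for n k :: nat
  have p: "p n k = (v n k, y n (- v n k), y n (v n k))" for n k
    unfolding p_def regularised_chain_def y_def v_def Let_def ..
  note reg = regularised_maximiser[OF K, folded y_def]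
  \<comment> \<open>Regularisation costs at most \<open>O(1 / n)\<close> in the maximum.\<close>
  have near_max: "w \<bullet> z \<le> w \<bullet> y n w + 2 * B * B / real (Suc n)" if "z \<in> K" for w z n
  proof -
    have "y n w \<bullet> (z - y n w) \<le> norm (y n w) * norm (z - y n w)" by (rule norm_cauchy_schwarz)
    also have "\<dots> \<le> B * (B + B)"
      using B[OF reg(1)] B[OF that] \<open>B \<ge> 0\<close>
      by (intro mult_mono order_trans[OF norm_triangle_ineq4] add_mono) auto
    finally have "y n w \<bullet> (z - y n w) / real (Suc n) \<le> 2 * B * B / real (Suc n)"
      by (intro divide_right_mono) auto
    then show ?thesis using reg(3)[OF that, of w n] by linarith
  qed
  have seg: "closed_segment (p n k) (p n (Suc k)) \<subseteq> A n" if "k < Suc n" for n k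
  proof
    fix q assume "q \<in> closed_segment (p n k) (p n (Suc k))"
    then obtain u where u: "0 \<le> u" "u \<le> 1" "q = (1 - u) *\<^sub>R p n k + u *\<^sub>R p n (Suc k)"
      by (auto simp: in_segment)
    define w x z where "w = (1 - u) *\<^sub>R v n k + u *\<^sub>R v n (Suc k)"
      and "x = (1 - u) *\<^sub>R y n (- v n k) + u *\<^sub>R y n (- v n (Suc k))"
      and "z = (1 - u) *\<^sub>R y n (v n k) + u *\<^sub>R y n (v n (Suc k))"
    have q: "q = (w, x, z)" by (simp add: u(3) p w_def x_def z_def)
    have v_Suc: "v n (Suc k) - v n k = (1 / real (Suc n)) *\<^sub>R d"
      by (simp add: v_def add_divide_distrib scaleR_add_left)
    have w_eq: "w = r + ((real k + u) / real (Suc n)) *\<^sub>R d"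
    proof -
      have "w = v n k + u *\<^sub>R (v n (Suc k) - v n k)" by (simp add: w_def algebra_simps)
      then show ?thesis
        unfolding v_Suc by (simp add: v_def add_divide_distrib scaleR_add_left)
    qed
    have "(real k + u) / real (Suc n) \<le> 1"
      using that u(2) by (simp add: divide_le_eq_1)
    then have "w \<in> closed_segment r (r + d)"
      unfolding w_eq in_segment using u(1)
      by (intro exI[of _ "(real k + u) / real (Suc n)"]) (auto simp: algebra_simps)
    moreover have "x \<in> K" "z \<in> K"
      unfolding x_def z_def using u by (auto intro!: convexD[OF K(2)] reg(1))
    moreover have "w \<bullet> (y' - x') \<le> w \<bullet> (z - x) + \<eta> n" if mem: "x' \<in> K" "y' \<in> K" for x' y'
    proof -
      have vertex: "w \<bullet> ((y' - x') - (y n (v n j) - y n (- v n j))) \<le> \<eta> n"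
        if "norm (w - v n j) \<le> norm d / real (Suc n)" for j
      proof -
        let ?t = "(y' - x') - (y n (v n j) - y n (- v n j))"
        have "norm ?t \<le> (B + B) + (B + B)"
          by (intro order_trans[OF norm_triangle_ineq4] add_mono B reg(1) mem)
        then have "(w - v n j) \<bullet> ?t \<le> norm d / real (Suc n) * (4 * B)"
          using that by (intro order_trans[OF norm_cauchy_schwarz] mult_mono) auto
        moreover have "v n j \<bullet> ?t \<le> 2 * (2 * B * B / real (Suc n))"
          using near_max[OF mem(2), of "v n j" n] near_max[OF mem(1), of "- v n j" n]
          by (simp add: inner_diff_right)
        ultimately have "w \<bullet> ?t \<le> norm d / real (Suc n) * (4 * B) + 2 * (2 * B * B / real (Suc n))"
          by (simp add: inner_diff_left)
        also have "\<dots> = \<eta> n" by (simp add: \<eta>_def add_divide_distrib mult_ac)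
        finally show ?thesis .
      qed
      have "w - v n k = (u / real (Suc n)) *\<^sub>R d" "w - v n (Suc k) = ((u - 1) / real (Suc n)) *\<^sub>R d"
        unfolding w_eq v_def by (simp_all add: add_divide_distrib diff_divide_distrib scaleR_add_left scaleR_diff_left)
      then have "norm (w - v n k) \<le> norm d / real (Suc n)" "norm (w - v n (Suc k)) \<le> norm d / real (Suc n)"
        using u(1,2) by (auto simp: divide_right_mono mult_left_le_one_le simp del: of_nat_Suc)
      from vertex[OF this(1)] vertex[OF this(2)]
      have "(1 - u) * (w \<bullet> ((y' - x') - (y n (v n k) - y n (- v n k))))
         + u * (w \<bullet> ((y' - x') - (y n (v n (Suc k)) - y n (- v n (Suc k))))) \<le> (1 - u) * \<eta> n + u * \<eta> n"
        using u by (intro add_mono mult_left_mono) auto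
      then show ?thesis
        by (simp add: x_def z_def inner_diff_right inner_add_right algebra_simps)
    qed
    ultimately show "q \<in> A n" by (simp add: q A_def)
  qed
  have bdd: "bounded (A 0)"
    by (rule bounded_subset[OF bounded_Times[OF bounded_closed_segment[of r "r + d"]
            bounded_Times[OF compact_imp_bounded compact_imp_bounded]], OF K(1) K(1)])
       (auto simp: A_def)
  have cl: "closed (A n)" for n
  proof -
    have "A n = (closed_segment r (r + d) \<times> K \<times> K) \<inter>
      (\<Inter>x'\<in>K. \<Inter>y'\<in>K. {q. fst q \<bullet> (y' - x') \<le> fst q \<bullet> (snd (snd q) - fst (snd q)) + \<eta> n})"
      by (auto simp: A_def)
    then show ?thesis
      using compact_imp_closed[OF K(1)]
      by (auto intro!: closed_Int closed_Times closed_INT closed_Collect_le continuous_intros)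
  qed
  have dec: "A n \<subseteq> A m" if "m \<le> n" for m n
  proof -
    have "\<eta> n \<le> \<eta> m"
      unfolding \<eta>_def using that \<open>B \<ge> 0\<close> by (intro frac_le) auto
    then have "s \<le> t + \<eta> m" if "s \<le> t + \<eta> n" for s t
      using that by linarith
    then show ?thesis by (auto simp: A_def)
  qed
  have ends: "p n 0 \<in> {r} \<times> UNIV" "p n (Suc n) \<in> {r + d} \<times> UNIV" for n
    by (auto simp: p v_def)
  have closed_fibre: "closed ({w :: 'a} \<times> (UNIV :: ('a \<times> 'a) set))" for w
    by (simp add: closed_Times)
  obtain g where g: "path g" "\<And>n. path_image g \<subseteq> A n"
      "pathstart g \<in> {r} \<times> UNIV" "pathfinish g \<in> {r + d} \<times> UNIV"
    using chains_limit_path[where p = p and N = Suc and A = A, OF freq[folded p_def] zero_less_Suc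
        seg cl dec bdd closed_fibre ends(1) closed_fibre ends(2)] by blast
  have "path_image g \<subseteq> supporting_bundle K (closed_segment r (r + d))"
  proof (intro subsetI)
    fix q assume "q \<in> path_image g"
    then have q: "q \<in> A n" for n using g(2) by blast
    obtain w x z where [simp]: "q = (w, x, z)" by (cases q) auto
    have lim: "(\<lambda>n. w \<bullet> (z - x) + \<eta> n) \<longlonglongrightarrow> w \<bullet> (z - x) + 0"
      unfolding \<eta>_def by (intro tendsto_intros lim_const_over_n[THEN LIMSEQ_Suc])
    have "w \<bullet> (y' - x') \<le> w \<bullet> (z - x)" if "x' \<in> K" "y' \<in> K" for x' y'
      using LIMSEQ_le_const[OF lim, of "w \<bullet> (y' - x')"] q that by (auto simp: A_def)
    then show "q \<in> supporting_bundle K (closed_segment r (r + d))"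
      using q[of 0] by (auto simp: supporting_bundle_def supporting_pairs_def A_def)
  qed
  then show ?thesis using that[OF g(1)] g(3,4) by auto
qed

section \<open>Supporting pairs over a grid of directions\<close>

definition rational_vectors :: "'a::euclidean_space set" where
  "rational_vectors = {x. \<forall>i\<in>Basis. x \<bullet> i \<in> \<rat>}"

lemma countable_rational_vectors: "countable (rational_vectors :: 'a::euclidean_space set)"
proof (rule countable_subset)
  show "countable ((\<lambda>f. \<Sum>i\<in>(Basis::'a set). f i *\<^sub>R i) ` (Basis \<rightarrow>\<^sub>E \<rat>))"
    by (intro countable_image countable_PiE countable_rat) auto
  show "rational_vectors \<subseteq> (\<lambda>f. \<Sum>i\<in>(Basis::'a set). f i *\<^sub>R i) ` (Basis \<rightarrow>\<^sub>E \<rat>)"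
  proof
    fix x :: 'a assume "x \<in> rational_vectors"
    then have "restrict (\<lambda>i. x \<bullet> i) Basis \<in> Basis \<rightarrow>\<^sub>E \<rat>" by (auto simp: rational_vectors_def)
    moreover have "x = (\<Sum>i\<in>Basis. restrict (\<lambda>i. x \<bullet> i) Basis i *\<^sub>R i)"
      by (simp add: euclidean_representation)
    ultimately show "x \<in> (\<lambda>f. \<Sum>i\<in>(Basis::'a set). f i *\<^sub>R i) ` (Basis \<rightarrow>\<^sub>E \<rat>)" by blast
  qed
qed

lemma translated_rational_vectors_dense:
  fixes T :: "'a::euclidean_space set"
  assumes "open T" "T \<noteq> {}"
  obtains x where "x \<in> T" "x - s \<in> rational_vectors"
proof -
  obtain v where "v \<in> T" using assms(2) by blast
  then obtain l u where lu: "v \<in> box l u" "box l u \<subseteq> T"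
    using open_contains_box[OF assms(1)] by metis
  have "\<forall>i\<in>Basis. \<exists>q\<in>\<rat>. l \<bullet> i - s \<bullet> i < q \<and> q < u \<bullet> i - s \<bullet> i"
    using lu(1) by (intro ballI Rats_dense_in_real) (force simp: mem_box)
  then obtain q where q: "\<And>i. i \<in> Basis \<Longrightarrow> q i \<in> \<rat> \<and> l \<bullet> i - s \<bullet> i < q i \<and> q i < u \<bullet> i - s \<bullet> i"
    by metis
  define x where "x = s + (\<Sum>i\<in>Basis. q i *\<^sub>R i)"
  have "x \<bullet> i = s \<bullet> i + q i" if "i \<in> Basis" for i
    using that by (simp add: x_def inner_add_left)
  then have "x \<in> box l u" "x - s \<in> rational_vectors"
    using q by (auto simp: mem_box rational_vectors_def inner_diff_left) (smt (verit) q)+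
  then show ?thesis using that lu(2) by blast
qed

lemma convex_chord_halfspace: "convex {p :: 'a::real_inner \<times> 'a. c \<le> v \<bullet> (snd p - fst p)}"
proof (rule convexI)
  fix p q :: "'a \<times> 'a" and a b :: real
  assume pq: "p \<in> {p. c \<le> v \<bullet> (snd p - fst p)}" "q \<in> {p. c \<le> v \<bullet> (snd p - fst p)}"
    and ab: "0 \<le> a" "0 \<le> b" "a + b = 1"
  have "c = a * c + b * c" using ab(3) by (metis distrib_right mult_1)
  also have "\<dots> \<le> a * (v \<bullet> (snd p - fst p)) + b * (v \<bullet> (snd q - fst q))"
    using pq ab by (intro add_mono mult_left_mono) auto
  finally show "a *\<^sub>R p + b *\<^sub>R q \<in> {p. c \<le> v \<bullet> (snd p - fst p)}"
    by (simp add: inner_add_right inner_diff_right right_diff_distrib)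
qed

lemma convex_supporting_pairs:
  assumes "convex K"
  shows "convex (supporting_pairs K v)"
proof -
  have "supporting_pairs K v = (K \<times> K) \<inter>
      (\<Inter>x'\<in>K. \<Inter>y'\<in>K. {p. v \<bullet> (y' - x') \<le> v \<bullet> (snd p - fst p)})"
    by (auto simp: supporting_pairs_def)
  then show ?thesis
    using assms by (auto intro!: convex_Int convex_Times convex_INT convex_chord_halfspace)
qed

lemma supporting_pairs_nonempty:
  fixes K :: "'a::euclidean_space set"
  assumes "compact K" "K \<noteq> {}"
  shows "supporting_pairs K v \<noteq> {}"
proof -
  have "\<exists>p\<in>K \<times> K. \<forall>q\<in>K \<times> K. v \<bullet> (snd q - fst q) \<le> v \<bullet> (snd p - fst p)"
    using assms by (intro continuous_attains_sup compact_Times continuous_intros) auto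
  then obtain x y where "x \<in> K" "y \<in> K" "\<forall>q\<in>K \<times> K. v \<bullet> (snd q - fst q) \<le> v \<bullet> (y - x)"
    by auto
  then have "(x, y) \<in> supporting_pairs K v"
    unfolding supporting_pairs_def by force
  then show ?thesis by blast
qed

text \<open>Any two supporting pairs in the directions \<open>a\<close> and \<open>b\<close> are joined by a path in the bundle over \<open>W\<close>.
If \<open>K\<close> is compact, convex and nonempty, the fibres are convex and nonempty, and it would be the same to ask for one path from the fibre over \<open>a\<close>
to the fibre over \<open>b\<close>, provided both lie in \<open>W\<close>.\<close>

definition linked_over :: "'a::euclidean_space set \<Rightarrow> 'a set \<Rightarrow> 'a \<Rightarrow> 'a \<Rightarrow> bool" where
  "linked_over K W a b \<longleftrightarrow> (\<forall>p\<in>supporting_pairs K a. \<forall>q\<in>supporting_pairs K b.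
     path_component (supporting_bundle K W) (a, p) (b, q))"

lemma linked_over_sym: "linked_over K W a b \<Longrightarrow> linked_over K W b a"
  by (auto simp: linked_over_def intro: path_component_sym)

lemma linked_over_mono:
  assumes "linked_over K W a b" "W \<subseteq> W'"
  shows "linked_over K W' a b"
proof -
  have "supporting_bundle K W \<subseteq> supporting_bundle K W'"
    using assms(2) by (auto simp: supporting_bundle_def)
  then show ?thesis
    using assms(1) unfolding linked_over_def by (blast intro: path_component_of_subset)
qed

lemma linked_over_trans:
  assumes "linked_over K W a b" "linked_over K W b c" "compact K" "K \<noteq> {}"
  shows "linked_over K W a c"
proof -
  obtain m where "m \<in> supporting_pairs K b"
    using supporting_pairs_nonempty[OF assms(3,4)] by blast
  then show ?thesis
    using assms(1,2) unfolding linked_over_def by (blast intro: path_component_trans)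
qed

lemma fibre_path_component:
  assumes "convex K" "a \<in> W" "p \<in> supporting_pairs K a" "q \<in> supporting_pairs K a"
  shows "path_component (supporting_bundle K W) (a, p) (a, q)"
  by (rule path_component_convex_subset[of "{a} \<times> supporting_pairs K a"])
     (use assms convex_supporting_pairs[OF assms(1)] in \<open>auto simp: supporting_bundle_def convex_Times\<close>)

lemma linked_over_refl: "convex K \<Longrightarrow> a \<in> W \<Longrightarrow> linked_over K W a a"
  by (simp add: linked_over_def fibre_path_component)

lemma linked_over_path:
  assumes "convex K" and g: "path g" "path_image g \<subseteq> supporting_bundle K W"
    and "fst (pathstart g) = a" "fst (pathfinish g) = b"
  shows "linked_over K W a b"
  unfolding linked_over_def
proof (intro ballI)
  fix p q assume pq: "p \<in> supporting_pairs K a" "q \<in> supporting_pairs K b"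
  obtain p' q' where ends: "pathstart g = (a, p')" "pathfinish g = (b, q')"
    using assms(4,5) by (metis prod.collapse)
  then have "(a, p') \<in> supporting_bundle K W" "(b, q') \<in> supporting_bundle K W"
    using g(2) pathstart_in_path_image[of g] pathfinish_in_path_image[of g] by auto
  then have "a \<in> W" "b \<in> W" "p' \<in> supporting_pairs K a" "q' \<in> supporting_pairs K b"
    by (auto simp: supporting_bundle_def)
  then have "path_component (supporting_bundle K W) (a, p) (a, p')"
    "path_component (supporting_bundle K W) (b, q') (b, q)"
    using pq fibre_path_component[OF assms(1)] by auto
  moreover have "path_component (supporting_bundle K W) (a, p') (b, q')"
    unfolding path_component_def using g ends by blast
  ultimately show "path_component (supporting_bundle K W) (a, p) (b, q)"
    using path_component_trans by blast
qed

text \<open>Every segment that is parallel to an axis, has rational length and starts in the dense grid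
\<open>s + rational_vectors\<close> lifts to the supporting bundle.\<close>

definition lifting_grid :: "'a::euclidean_space set \<Rightarrow> 'a \<Rightarrow> bool" where
  "lifting_grid K s \<longleftrightarrow> (\<forall>r e c. r - s \<in> rational_vectors \<longrightarrow> e \<in> Basis \<longrightarrow> c \<in> \<rat> \<longrightarrow> c > 0 \<longrightarrow>
     linked_over K (closed_segment r (r + c *\<^sub>R e)) r (r + c *\<^sub>R e))"

text \<open>Such a grid exists because it consists of countably many segments, each of which lifts for almost
every \<open>s\<close>.\<close>

lemma exists_lifting_grid:
  fixes K :: "'a::euclidean_space set"
  assumes K: "compact K" "convex K" "K \<noteq> {}"
  obtains s where "lifting_grid K s"
proof -
  define X :: "('a \<times> 'a \<times> real) set" where "X = rational_vectors \<times> Basis \<times> (\<rat> \<inter> {0<..})"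
  define good where "good s x \<longleftrightarrow> (case x of (\<rho>, e, c) \<Rightarrow>
     norm s < 1 \<longrightarrow> (\<exists>L. \<exists>\<^sub>F n in sequentially.
       (\<Sum>k<Suc n. norm (regularised_chain K (s + \<rho>) (c *\<^sub>R e) n (Suc k)
                      - regularised_chain K (s + \<rho>) (c *\<^sub>R e) n k)) \<le> L))" for s :: 'a and x
  have "countable X"
    unfolding X_def
    by (intro countable_SIGMA countable_rational_vectors countable_finite[OF finite_Basis]
        countable_subset[OF Int_lower1 countable_rat])
  moreover have "AE s in lborel. good s x" if "x \<in> X" for x
    using that AE_bounded_chain_length[OF K] by (auto simp: X_def good_def simp del: sum.lessThan_Suc)
  ultimately have AE: "AE s in lborel. \<forall>x\<in>X. good s x"
    by (simp add: AE_ball_countable)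
  have "\<exists>s::'a. norm s < 1 \<and> (\<forall>x\<in>X. good s x)"
  proof (rule ccontr)
    assume "\<nexists>s::'a. norm s < 1 \<and> (\<forall>x\<in>X. good s x)"
    then have "\<not> norm s < 1" if "\<forall>x\<in>X. good s x" for s using that by blast
    then have "AE s::'a in lborel. \<not> norm s < 1" using AE by (rule eventually_mono[rotated])
    then have "emeasure lborel {s::'a. norm s < 1} = 0"
      using emeasure_eq_0_AE[of "\<lambda>s. norm s < 1" "lborel :: 'a measure"] by simp
    moreover have "{s::'a. norm s < 1} = ball 0 1" by auto
    ultimately show False
      using content_ball_pos[of 1 "0::'a"] by (simp add: measure_def)
  qed
  then obtain s :: 'a where s: "norm s < 1" "\<forall>x\<in>X. good s x" by blast
  show ?thesis
  proof (rule that[of s], unfold lifting_grid_def, intro allI impI)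
    fix r e :: 'a and c :: real
    assume r: "r - s \<in> rational_vectors" and "e \<in> Basis" "c \<in> \<rat>" "c > 0"
    then have "good s (r - s, e, c)" using s(2) by (simp add: X_def)
    then obtain L where "\<exists>\<^sub>F n in sequentially.
       (\<Sum>k<Suc n. norm (regularised_chain K r (c *\<^sub>R e) n (Suc k)
                      - regularised_chain K r (c *\<^sub>R e) n k)) \<le> L"
      using s(1) by (auto simp: good_def simp del: sum.lessThan_Suc)
    from supporting_bundle_path_over_segment[OF K this]
    show "linked_over K (closed_segment r (r + c *\<^sub>R e)) r (r + c *\<^sub>R e)"
      using linked_over_path[OF K(2)] by metis
  qed
qed

lemma grid_linked_over_box:
  fixes K :: "'a::euclidean_space set"
  assumes K: "compact K" "convex K" "K \<noteq> {}"
    and grid: "lifting_grid K s"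
    and "a \<in> box l u" "b \<in> box l u" "a - s \<in> rational_vectors" "b - s \<in> rational_vectors"
  shows "linked_over K (box l u) a b"
proof -
  have lines: "linked_over K (closed_segment r (r + c *\<^sub>R e)) r (r + c *\<^sub>R e)"
    if "r - s \<in> rational_vectors" "e \<in> Basis" "c \<in> \<rat>" "c > 0" for r e c
    using grid that unfolding lifting_grid_def by blast
  \<comment> \<open>The coordinates are changed one at a time; the set \<open>J\<close> contains those still to be changed.\<close>
  have "\<forall>a. a \<in> box l u \<and> a - s \<in> rational_vectors \<and> (\<forall>i\<in>Basis - J. a \<bullet> i = b \<bullet> i)
     \<longrightarrow> linked_over K (box l u) a b" if "finite J" "J \<subseteq> Basis" for J
    using that
  proof (induction J)
    case empty
    then show ?case
      using linked_over_refl[OF K(2) \<open>b \<in> box l u\<close>] by (metis Diff_empty euclidean_eqI)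
  next
    case (insert j J)
    show ?case
    proof (intro allI impI, elim conjE)
      fix a assume a: "a \<in> box l u" "a - s \<in> rational_vectors" "\<forall>i\<in>Basis - insert j J. a \<bullet> i = b \<bullet> i"
      have j: "j \<in> Basis" using insert.prems by blast
      define c where "c = b \<bullet> j - a \<bullet> j"
      define a' where "a' = a + c *\<^sub>R j"
      have a': "a' \<bullet> i = (if i = j then b \<bullet> i else a \<bullet> i)" if "i \<in> Basis" for i
        using that j by (auto simp: a'_def c_def inner_add_left inner_Basis)
      have "c = (b - s) \<bullet> j - (a - s) \<bullet> j" by (simp add: c_def inner_diff_left)
      then have "c \<in> \<rat>"
        using a(2) \<open>b - s \<in> rational_vectors\<close> j by (auto simp: rational_vectors_def)
      have a'_box: "a' \<in> box l u"
        using a(1) \<open>b \<in> box l u\<close> a' by (auto simp: mem_box)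
      have a'_grid: "a' - s \<in> rational_vectors"
        using a(2) \<open>b - s \<in> rational_vectors\<close> a' by (auto simp: rational_vectors_def inner_diff_left)
      have "linked_over K (box l u) a' b"
        using insert.IH insert.prems a'_box a'_grid a' a(3) by auto
      moreover have "linked_over K (box l u) a a'"
      proof -
        have sub: "closed_segment a a' \<subseteq> box l u" "closed_segment a' a \<subseteq> box l u"
          using closed_segment_subset[OF a(1) a'_box] by (simp_all add: closed_segment_commute)
        consider "c = 0" | "c > 0" | "- c > 0" by linarith
        then show ?thesis
        proof cases
          case 1
          then show ?thesis using linked_over_refl[OF K(2) a(1)] by (simp add: a'_def)
        next
          case 2
          then show ?thesis
            using lines[OF a(2) j \<open>c \<in> \<rat>\<close>] sub by (auto simp: a'_def intro: linked_over_mono)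
        next
          case 3
          then have "linked_over K (closed_segment a' (a' + (- c) *\<^sub>R j)) a' (a' + (- c) *\<^sub>R j)"
            using lines[OF a'_grid j _ 3] \<open>c \<in> \<rat>\<close> by simp
          moreover have "a' + (- c) *\<^sub>R j = a" by (simp add: a'_def)
          ultimately show ?thesis using sub(2) linked_over_mono linked_over_sym by metis
        qed
      qed
      ultimately show "linked_over K (box l u) a b"
        using linked_over_trans K by blast
    qed
  qed
  from this[of Basis] show ?thesis using assms by auto
qed

definition long_chords :: "'a::euclidean_space set \<Rightarrow> ('a \<times> 'a) set" where
  "long_chords K = {(x, y). x \<in> K \<and> y \<in> K \<and> 1 \<le> norm (y - x)}"

text \<open>Chords whose component along \<open>v\<close> is at least 1. The condition depends only on the direction of \<open>v\<close>
and defines, for convex \<open>K\<close>, a convex set of chords of length at least 1. The value at \<open>v = 0\<close> is of no interest.\<close>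

definition long_cap :: "'a::euclidean_space set \<Rightarrow> 'a \<Rightarrow> ('a \<times> 'a) set" where
  "long_cap K v = {(x, y). x \<in> K \<and> y \<in> K \<and> norm v \<le> v \<bullet> (y - x)}"

lemma long_cap_iff: "p \<in> long_cap K v \<longleftrightarrow> fst p \<in> K \<and> snd p \<in> K \<and> norm v \<le> v \<bullet> (snd p - fst p)"
  by (cases p) (simp add: long_cap_def)

lemma convex_long_cap:
  assumes "convex K"
  shows "convex (long_cap K v)"
proof -
  have "long_cap K v = (K \<times> K) \<inter> {p. norm v \<le> v \<bullet> (snd p - fst p)}"
    by (auto simp: long_cap_def)
  then show ?thesis
    using assms by (auto intro!: convex_Int convex_Times convex_chord_halfspace)
qed

lemma long_cap_subset_long_chords:
  assumes "v \<noteq> 0"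
  shows "long_cap K v \<subseteq> long_chords K"
proof -
  have "1 \<le> norm (y - x)" if "norm v \<le> v \<bullet> (y - x)" for x y
  proof -
    have "norm v * 1 \<le> norm v * norm (y - x)"
      using that norm_cauchy_schwarz[of v "y - x"] by simp
    then show ?thesis using assms by simp
  qed
  then show ?thesis by (auto simp: long_cap_def long_chords_def)
qed

section \<open>Path-connectedness of the long chords\<close>

lemma closed_long_chords:
  fixes K :: "'a::euclidean_space set"
  assumes "compact K"
  shows "closed (long_chords K)"
proof -
  have "long_chords K = (K \<times> K) \<inter> {p. 1 \<le> norm (snd p - fst p)}"
    by (auto simp: long_chords_def)
  then show ?thesis
    using compact_imp_closed[OF assms]
    by (auto intro!: closed_Int closed_Times closed_Collect_le continuous_intros)
qed

lemma norm_le_inner_self: "1 \<le> norm v \<Longrightarrow> norm v \<le> v \<bullet> (v :: 'a::real_inner)"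
  using mult_right_mono[of 1 "norm v" "norm v"] by (simp add: dot_square_norm power2_eq_square)

text \<open>A compact convex set whose width is at least 1 in every direction; the case \<open>v = 0\<close> of the condition makes it nonempty.\<close>

locale unit_width_body =
  fixes K :: "'a::euclidean_space set"
  assumes compact_K: "compact K" and convex_K: "convex K"
    and width: "\<And>v. \<exists>x\<in>K. \<exists>y\<in>K. norm v \<le> v \<bullet> (y - x)"
begin

lemma nonempty_K: "K \<noteq> {}"
  using width[of 0] by blast

lemma supporting_pairs_subset_long_cap: "supporting_pairs K v \<subseteq> long_cap K v"
  using width[of v] by (fastforce simp: supporting_pairs_def long_cap_def)

lemma path_component_long_cap:
  "v \<noteq> 0 \<Longrightarrow> p \<in> long_cap K v \<Longrightarrow> q \<in> long_cap K v \<Longrightarrow> path_component (long_chords K) p q"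
  using path_component_convex_subset convex_long_cap[OF convex_K] long_cap_subset_long_chords by metis

lemma snd_supporting_bundle_subset:
  assumes "0 \<notin> W"
  shows "snd ` supporting_bundle K W \<subseteq> long_chords K"
proof
  fix p assume "p \<in> snd ` supporting_bundle K W"
  then obtain v where v: "v \<in> W" "p \<in> supporting_pairs K v" by (auto simp: supporting_bundle_def)
  then have "v \<noteq> 0" using assms by blast
  then show "p \<in> long_chords K"
    using v(2) supporting_pairs_subset_long_cap long_cap_subset_long_chords by blast
qed

lemma linked_over_imp_path_component:
  assumes "linked_over K W a b" "0 \<notin> W" "p \<in> supporting_pairs K a" "q \<in> supporting_pairs K b"
  shows "path_component (long_chords K) p q"
proof -
  have "path_component (long_chords K) (snd (a, p)) (snd (b, q))"
    by (rule path_component_continuous_image[of "supporting_bundle K W"])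
       (use assms snd_supporting_bundle_subset[OF assms(2)] in
         \<open>auto simp: linked_over_def intro: continuous_intros\<close>)
  then show ?thesis by simp
qed

text \<open>Upper semicontinuity: if the cap of \<open>v\<close> is a single chord \<open>p\<close>, all supporting pairs in directions
near \<open>v\<close> are near \<open>p\<close>.\<close>

lemma supporting_pairs_converge:
  assumes unique: "long_cap K v = {p}" and "r > 0"
  obtains \<epsilon> where "\<epsilon> > 0" "\<And>w. norm (w - v) < \<epsilon> \<Longrightarrow> supporting_pairs K w \<subseteq> ball p r"
proof (rule ccontr)
  assume no: "\<not> thesis"
  have "\<exists>w m. norm (w - v) < 1 / real (Suc n) \<and> m \<in> supporting_pairs K w \<and> r \<le> dist m p" for n
  proof (rule ccontr)
    assume "\<nexists>w m. norm (w - v) < 1 / real (Suc n) \<and> m \<in> supporting_pairs K w \<and> r \<le> dist m p"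
    then have "supporting_pairs K w \<subseteq> ball p r" if "norm (w - v) < 1 / real (Suc n)" for w
      using that by (fastforce simp: dist_commute)
    then show False using no that[of "1 / real (Suc n)"] by simp
  qed
  then obtain w m where wm: "\<And>n. norm (w n - v) < 1 / real (Suc n)"
      "\<And>n. m n \<in> supporting_pairs K (w n)" "\<And>n. r \<le> dist (m n) p"
    by metis
  have cap: "m n \<in> long_cap K (w n)" for n using wm(2) supporting_pairs_subset_long_cap by blast
  then have "\<forall>n. m n \<in> K \<times> K" by (simp add: long_cap_iff mem_Times_iff)
  then obtain l \<phi> where l: "l \<in> K \<times> K" "strict_mono \<phi>" "(m \<circ> \<phi>) \<longlonglongrightarrow> l"
    using compact_Times[OF compact_K compact_K] unfolding compact_def by metis
  have "w \<longlonglongrightarrow> v"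
    using LIMSEQ_norm_0[OF wm(1)] by (rule LIM_zero_cancel)
  then have w_lim: "(w \<circ> \<phi>) \<longlonglongrightarrow> v" using l(2) LIMSEQ_subseq_LIMSEQ by blast
  have "norm v \<le> v \<bullet> (snd l - fst l)"
  proof (rule LIMSEQ_le)
    show "(\<lambda>n. norm ((w \<circ> \<phi>) n)) \<longlonglongrightarrow> norm v"
      by (intro tendsto_intros w_lim)
    show "(\<lambda>n. (w \<circ> \<phi>) n \<bullet> (snd ((m \<circ> \<phi>) n) - fst ((m \<circ> \<phi>) n))) \<longlonglongrightarrow> v \<bullet> (snd l - fst l)"
      by (intro tendsto_intros w_lim l(3))
    show "\<exists>N. \<forall>n\<ge>N. norm ((w \<circ> \<phi>) n) \<le> (w \<circ> \<phi>) n \<bullet> (snd ((m \<circ> \<phi>) n) - fst ((m \<circ> \<phi>) n))"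
      using cap by (simp add: long_cap_iff)
  qed
  then have "l \<in> long_cap K v" using l(1) by (auto simp: long_cap_def)
  then have "l = p" using unique by simp
  then have "(\<lambda>n. dist ((m \<circ> \<phi>) n) p) \<longlonglongrightarrow> dist p p"
    using l(3) by (intro tendsto_intros) (simp add: comp_def)
  then have "r \<le> dist p p"
    by (rule LIMSEQ_le_const) (use wm(3) in auto)
  then show False using \<open>r > 0\<close> by simp
qed

text \<open>If the cap of the direction of a chord contains no chord longer than 1, then all its chords are
translates of each other, and combining the ends of two of them shows that they coincide.\<close>

lemma long_cap_unique:
  assumes p: "(x, y) \<in> long_chords K" and short: "\<And>x' y'. (x', y') \<in> long_cap K (y - x) \<Longrightarrow> norm (y' - x') \<le> 1"
  shows "long_cap K (y - x) = {(x, y)}"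
proof -
  define v where "v = y - x"
  have mem: "x \<in> K" "y \<in> K" "1 \<le> norm v" using p by (auto simp: long_chords_def v_def)
  have "norm v \<le> v \<bullet> v"
    using mem(3) by (rule norm_le_inner_self)
  then have self: "(x, y) \<in> long_cap K v" using mem by (simp add: long_cap_def v_def)
  then have v1: "norm v = 1" using short[of x y] mem(3) by (simp add: v_def)
  have dir: "y' - x' = v" if "(x', y') \<in> long_cap K v" for x' y'
  proof -
    have "norm (y' - x') \<le> 1" using short that by (simp add: v_def)
    then have "(y' - x') \<bullet> (y' - x') \<le> 1" by (simp add: dot_square_norm power_le_one)
    moreover have "1 \<le> v \<bullet> (y' - x')" using that v1 by (simp add: long_cap_def)
    moreover have "v \<bullet> v = 1" using v1 by (simp add: dot_square_norm)
    ultimately have "((y' - x') - v) \<bullet> ((y' - x') - v) \<le> 0"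
      by (simp only: inner_diff_left[of "y' - x'" v] inner_diff_right[of _ "y' - x'" v] inner_commute[of "y' - x'" v])
    then show ?thesis by (metis inner_ge_zero inner_eq_zero_iff order_antisym right_minus_eq)
  qed
  have "x' = x \<and> y' = y" if cap: "(x', y') \<in> long_cap K v" for x' y'
  proof -
    have y': "y' = x' + v" using dir[OF cap] by (simp add: algebra_simps)
    have y: "y = x + v" by (simp add: v_def)
    have K': "x' \<in> K" "y' \<in> K" using cap by (auto simp: long_cap_def)
    have "v \<bullet> v = 1" using v1 by (simp add: dot_square_norm)
    have "x' = x"
    proof (cases "v \<bullet> (x' - x) \<ge> 0")
      case True
      then have "(x, y') \<in> long_cap K v"
        using mem K' v1 \<open>v \<bullet> v = 1\<close> by (simp add: long_cap_def y' inner_diff_right inner_add_right)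
      from dir[OF this] show ?thesis by (simp add: y')
    next
      case False
      then have "(x', y) \<in> long_cap K v"
        using mem K' v1 \<open>v \<bullet> v = 1\<close> by (simp add: long_cap_def y inner_diff_right inner_add_right)
      from dir[OF this] show ?thesis by (simp add: y)
    qed
    then show ?thesis by (simp add: y y')
  qed
  then show ?thesis using self unfolding v_def by auto
qed

text \<open>A chord that is alone in its cap is reached from the grid by concatenating infinitely many paths, which
connect supporting pairs over boxes \<open>W k\<close> that shrink to \<open>v\<close>.\<close>

lemma path_component_from_grid_unique_cap:
  assumes grid: "lifting_grid K s"
    and "v \<noteq> 0" and unique: "long_cap K v = {p}"
  obtains a q where "a - s \<in> rational_vectors" "a \<noteq> 0" "q \<in> supporting_pairs K a"
    "path_component (long_chords K) q p"
proof -
  \<comment> \<open>The factor \<open>DIM('a)\<close> puts the cube \<open>W k\<close> into the ball of radius \<open>norm v / (k + 1)\<close> about \<open>v\<close>,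
    which does not contain 0.\<close>
  define \<epsilon> where "\<epsilon> k = norm v / (DIM('a) * real (Suc k))" for k
  define W where "W k = box (v - \<epsilon> k *\<^sub>R One) (v + \<epsilon> k *\<^sub>R One)" for k
  have \<epsilon>_pos: "\<epsilon> k > 0" for k using \<open>v \<noteq> 0\<close> by (simp add: \<epsilon>_def)
  have in_W: "x \<in> W k \<longleftrightarrow> (\<forall>i\<in>Basis. \<bar>(x - v) \<bullet> i\<bar> < \<epsilon> k)" for x k
    unfolding W_def mem_box by (auto simp: inner_diff_left inner_add_left abs_less_iff)
  have W_norm: "norm (x - v) < norm v / real (Suc k)" if "x \<in> W k" for x k
  proof -
    have "norm (x - v) \<le> (\<Sum>i\<in>Basis. \<bar>(x - v) \<bullet> i\<bar>)" by (rule norm_le_l1)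
    also have "\<dots> < (\<Sum>i\<in>(Basis::'a set). \<epsilon> k)"
      using that in_W by (intro sum_strict_mono) auto
    also have "\<dots> = norm v / real (Suc k)" by (simp add: \<epsilon>_def)
    finally show ?thesis .
  qed
  have zero: "0 \<notin> W k" for k
  proof
    assume "0 \<in> W k"
    then have "norm v < norm v / real (Suc k)" using W_norm[of 0 k] by simp
    moreover have "norm v / real (Suc k) \<le> norm v / 1" by (intro divide_left_mono) auto
    ultimately show False by simp
  qed
  have dec: "W (Suc k) \<subseteq> W k" for k
  proof -
    have "\<epsilon> (Suc k) \<le> \<epsilon> k"
      unfolding \<epsilon>_def by (intro divide_left_mono mult_left_mono mult_pos_pos) auto
    then show ?thesis by (force simp: in_W)
  qed
  have "\<exists>a. a \<in> W k \<and> a - s \<in> rational_vectors" for k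
  proof -
    have "v \<in> W k" using \<epsilon>_pos by (simp add: in_W)
    then show ?thesis
      using translated_rational_vectors_dense[of "W k" s] unfolding W_def by (metis empty_iff open_box)
  qed
  then obtain a where a: "\<And>k. a k \<in> W k" "\<And>k. a k - s \<in> rational_vectors" by metis
  have "\<exists>q. q \<in> supporting_pairs K (a k)" for k
    using supporting_pairs_nonempty[OF compact_K nonempty_K] by blast
  then obtain q where q: "\<And>k. q k \<in> supporting_pairs K (a k)" by metis
  have "linked_over K (W k) (a k) (a (Suc k))" for k
    unfolding W_def
    by (rule grid_linked_over_box[OF compact_K convex_K nonempty_K grid])
       (use a(1)[of k] subsetD[OF dec a(1)[of "Suc k"]] a(2) in \<open>simp_all add: W_def\<close>)
  then have "path_component (supporting_bundle K (W k)) (a k, q k) (a (Suc k), q (Suc k))" for k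
    using q by (auto simp: linked_over_def)
  then obtain h where h: "\<And>k. path (h k)" "\<And>k. path_image (h k) \<subseteq> supporting_bundle K (W k)"
      "\<And>k. pathstart (h k) = (a k, q k)" "\<And>k. pathfinish (h k) = (a (Suc k), q (Suc k))"
    unfolding path_component_def by metis
  define g where "g k = snd \<circ> h k" for k
  have g_image: "path_image (g k) = snd ` path_image (h k)" for k
    by (simp add: g_def path_image_compose)
  have "path_component (long_chords K) (pathstart (g 0)) p"
  proof (rule path_component_infinite_concatenation)
    show "path (g k)" for k
      unfolding g_def by (intro path_continuous_image h(1) continuous_intros)
    show "path_image (g k) \<subseteq> long_chords K" for k
      using h(2)[of k] snd_supporting_bundle_subset[OF zero[of k]] unfolding g_image by blast
    show "pathfinish (g k) = pathstart (g (Suc k))" for k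
      by (simp add: g_def pathstart_compose pathfinish_compose h)
    show "closed (long_chords K)" by (rule closed_long_chords[OF compact_K])
    fix r :: real assume "r > 0"
    from supporting_pairs_converge[OF unique this] obtain \<delta> where
      \<delta>: "\<delta> > 0" "\<And>w. norm (w - v) < \<delta> \<Longrightarrow> supporting_pairs K w \<subseteq> ball p r" by blast
    obtain k0 :: nat where k0: "norm v / \<delta> < real k0" using reals_Archimedean2 by blast
    have "path_image (g k) \<subseteq> ball p r" if "k \<ge> k0" for k
    proof -
      have "norm v < \<delta> * real (Suc k)"
      proof -
        have "norm v < real k0 * \<delta>" using k0 \<delta>(1) by (simp add: pos_divide_less_eq)
        also have "\<dots> \<le> real (Suc k) * \<delta>" using that \<delta>(1) by (intro mult_right_mono) auto
        finally show ?thesis by (simp add: mult.commute)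
      qed
      then have "norm v / real (Suc k) < \<delta>" by (simp add: pos_divide_less_eq del: of_nat_Suc)
      then have "supporting_pairs K w \<subseteq> ball p r" if "w \<in> W k" for w
        using \<delta>(2) W_norm[OF that] by (meson less_trans)
      then show ?thesis
        using h(2)[of k] unfolding g_image by (force simp: supporting_bundle_def)
    qed
    then show "\<exists>k0. \<forall>k\<ge>k0. path_image (g k) \<subseteq> ball p r" by blast
  qed
  moreover have "pathstart (g 0) = q 0" by (simp add: g_def pathstart_compose h)
  moreover have "a 0 \<noteq> 0" using a(1)[of 0] zero[of 0] by metis
  ultimately show ?thesis using that a(2) q by metis
qed

text \<open>In the first case of the proof, the cap of the direction of \<open>p\<close> contains a chord longer than 1. That
chord lies in the caps of all directions in a nonempty open set, in particular in that of a grid direction.\<close>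

lemma path_component_from_grid:
  assumes grid: "lifting_grid K s"
    and p: "p \<in> long_chords K"
  obtains a q where "a - s \<in> rational_vectors" "a \<noteq> 0" "q \<in> supporting_pairs K a"
    "path_component (long_chords K) q p"
proof -
  obtain x y where xy: "p = (x, y)" by (cases p)
  define v where "v = y - x"
  have v: "1 \<le> norm v" "x \<in> K" "y \<in> K" using p by (auto simp: xy v_def long_chords_def)
  then have "v \<noteq> 0" by auto
  have "norm v \<le> v \<bullet> v" using v(1) by (rule norm_le_inner_self)
  then have self: "p \<in> long_cap K v" using v by (simp add: xy long_cap_def v_def)
  show ?thesis
  proof (cases "\<exists>x' y'. (x', y') \<in> long_cap K v \<and> norm (y' - x') > 1")
    case True
    then obtain x' y' where long: "(x', y') \<in> long_cap K v" "norm (y' - x') > 1" by blast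
    define u where "u = y' - x'"
    have "1 < norm u" using long(2) by (simp add: u_def)
    then have "norm u * 1 < norm u * norm u" by (intro mult_strict_left_mono) linarith+
    then have "u \<in> {a. norm a < a \<bullet> u}" by (simp add: dot_square_norm power2_eq_square)
    moreover have "open {a. norm a < a \<bullet> u}" by (intro open_Collect_less continuous_intros)
    ultimately obtain a where a: "norm a < a \<bullet> u" "a - s \<in> rational_vectors"
      using translated_rational_vectors_dense[of "{a. norm a < a \<bullet> u}" s] by blast
    then have "a \<noteq> 0" by auto
    obtain q where q: "q \<in> supporting_pairs K a"
      using supporting_pairs_nonempty[OF compact_K nonempty_K] by blast
    have "(x', y') \<in> long_cap K a" using a(1) long(1) by (simp add: long_cap_def u_def)
    then have "path_component (long_chords K) q (x', y')"
      using path_component_long_cap[OF \<open>a \<noteq> 0\<close>] q supporting_pairs_subset_long_cap by blast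
    moreover have "path_component (long_chords K) (x', y') p"
      by (rule path_component_long_cap[OF \<open>v \<noteq> 0\<close> long(1) self])
    ultimately show ?thesis using that a(2) \<open>a \<noteq> 0\<close> q path_component_trans by blast
  next
    case False
    then have "long_cap K v = {p}"
      using long_cap_unique[of x y] p unfolding xy v_def by force
    from path_component_from_grid_unique_cap[OF grid \<open>v \<noteq> 0\<close> this] that show ?thesis by blast
  qed
qed

text \<open>The hypothesis on the dimension makes the space of directions \<open>v \<noteq> 0\<close> connected.\<close>

theorem path_connected_long_chords:
  assumes "DIM('a) \<ge> 2"
  shows "path_connected (long_chords K)"
proof -
  obtain s where grid: "lifting_grid K s"
    using exists_lifting_grid[OF compact_K convex_K nonempty_K] by blast
  define R where "R a b \<longleftrightarrow> (\<forall>p\<in>supporting_pairs K a. \<forall>q\<in>supporting_pairs K b.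
     path_component (long_chords K) p q)" for a b
  have R: "R a b" if "a \<noteq> 0" "b \<noteq> 0" "a - s \<in> rational_vectors" "b - s \<in> rational_vectors" for a b
  proof (rule connected_equivalence_relation_gen[where S = "- {0}" and P = "\<lambda>x. x - s \<in> rational_vectors"])
    show "connected (- {0::'a})" by (rule connected_punctured_universe[OF assms])
    show "R x z" if "R x y" "R y z" for x y z
    proof -
      obtain m where "m \<in> supporting_pairs K y"
        using supporting_pairs_nonempty[OF compact_K nonempty_K] by blast
      then show ?thesis using that unfolding R_def by (blast intro: path_component_trans)
    qed
    show "\<exists>z. z \<in> T \<and> z - s \<in> rational_vectors" if "openin (top_of_set (- {0})) T" "a \<in> T" for T a
    proof -
      have "open T" by (rule openin_open_trans[OF that(1) open_Compl[OF closed_singleton]])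
      then show ?thesis using translated_rational_vectors_dense[of T s] that(2) by blast
    qed
    show "\<exists>T. openin (top_of_set (- {0})) T \<and> x \<in> T \<and>
        (\<forall>a\<in>T. \<forall>b\<in>T. a - s \<in> rational_vectors \<and> b - s \<in> rational_vectors \<longrightarrow> R a b)"
      if "x \<in> - {0}" for x
    proof -
      have "open (- {0::'a})" by (rule open_Compl[OF closed_singleton])
      with that obtain l u where lu: "x \<in> box l u" "box l u \<subseteq> - {0}"
        using open_contains_box by metis
      have "R a b" if "a \<in> box l u" "b \<in> box l u" "a - s \<in> rational_vectors" "b - s \<in> rational_vectors" for a b
        unfolding R_def
        using grid_linked_over_box[OF compact_K convex_K nonempty_K grid that]
          linked_over_imp_path_component lu(2) by blast
      then show ?thesis using lu by (intro exI[of _ "box l u"]) (auto intro: open_subset)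
    qed
  qed (use that in auto)
  show ?thesis
    unfolding path_connected_component
  proof (intro ballI)
    fix p q assume p: "p \<in> long_chords K" and q: "q \<in> long_chords K"
    obtain a p' where a: "a - s \<in> rational_vectors" "a \<noteq> 0" "p' \<in> supporting_pairs K a"
        "path_component (long_chords K) p' p"
      using path_component_from_grid[OF grid p] by blast
    obtain b q' where b: "b - s \<in> rational_vectors" "b \<noteq> 0" "q' \<in> supporting_pairs K b"
        "path_component (long_chords K) q' q"
      using path_component_from_grid[OF grid q] by blast
    have "path_component (long_chords K) p' q'"
      using R[of a b] a(1-3) b(1-3) unfolding R_def by blast
    then show "path_component (long_chords K) p q"
      using a(4) b(4) by (blast intro: path_component_sym path_component_trans)
  qed
qed

end

section \<open>Rotations that fix a vector\<close>

lemma continuous_on_matrix_matrix_mult [continuous_intros]: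
  fixes f :: "'a::topological_space \<Rightarrow> real^'n^'m" and g :: "'a \<Rightarrow> real^'k^'n"
  assumes "continuous_on S f" "continuous_on S g"
  shows "continuous_on S (\<lambda>x. f x ** g x)"
  unfolding matrix_matrix_mult_def using assms by (intro continuous_intros)

lemma continuous_on_matrix_vector_mult [continuous_intros]:
  fixes f :: "'a::topological_space \<Rightarrow> real^'n^'m" and g :: "'a \<Rightarrow> real^'n"
  assumes "continuous_on S f" "continuous_on S g"
  shows "continuous_on S (\<lambda>x. f x *v g x)"
  unfolding matrix_vector_mult_def using assms by (intro continuous_intros)

lemma continuous_on_det [continuous_intros]:
  fixes f :: "'a::topological_space \<Rightarrow> real^'n^'n"
  assumes "continuous_on S f"
  shows "continuous_on S (\<lambda>x. det (f x))"
  unfolding det_def using assms by (intro continuous_intros)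

text \<open>The reflection in the hyperplane orthogonal to \<open>u\<close>, where \<open>u \<noteq> 0\<close> need not be a unit vector.\<close>

definition reflection_matrix :: "real^'n \<Rightarrow> real^'n^'n" where
  "reflection_matrix u = (\<chi> i j. (if i = j then 1 else 0) - 2 * (u $ i * u $ j) / (u \<bullet> u))"

lemma reflection_matrix_vector_mult:
  "reflection_matrix u *v x = x - (2 * (u \<bullet> x) / (u \<bullet> u)) *\<^sub>R u"
proof -
  have "(reflection_matrix u *v x) $ i = (x - (2 * (u \<bullet> x) / (u \<bullet> u)) *\<^sub>R u) $ i" for i
  proof -
    have "(reflection_matrix u *v x) $ i
      = (\<Sum>j\<in>UNIV. (if i = j then x $ j else 0) - 2 * u $ i / (u \<bullet> u) * (u $ j * x $ j))"
      unfolding reflection_matrix_def matrix_vector_mult_def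
      by (simp add: left_diff_distrib) (intro sum.cong, auto)
    also have "\<dots> = x $ i - 2 * u $ i / (u \<bullet> u) * (u \<bullet> x)"
      by (simp add: sum_subtractf inner_vec_def[of u x] sum_distrib_left sum_divide_distrib)
    finally show ?thesis by simp
  qed
  then show ?thesis by (simp add: vec_eq_iff)
qed

lemma reflection_matrix_involution:
  assumes "u \<noteq> 0"
  shows "reflection_matrix u ** reflection_matrix u = mat 1"
proof -
  have "reflection_matrix u *v (reflection_matrix u *v x) = x" for x
    using assms by (simp add: reflection_matrix_vector_mult inner_diff_right field_simps)
  then show ?thesis by (simp add: matrix_eq matrix_vector_mul_assoc)
qed

lemma orthogonal_reflection_matrix:
  assumes "u \<noteq> 0"
  shows "orthogonal_matrix (reflection_matrix u)"
proof -
  have "transpose (reflection_matrix u) = reflection_matrix u"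
    by (simp add: reflection_matrix_def transpose_def vec_eq_iff mult.commute)
  then show ?thesis
    by (simp add: orthogonal_matrix reflection_matrix_involution[OF assms])
qed

lemma reflection_matrix_fixes: "u \<bullet> x = 0 \<Longrightarrow> reflection_matrix u *v x = x"
  by (simp add: reflection_matrix_vector_mult)

lemma reflection_matrix_scaleR: "k \<noteq> 0 \<Longrightarrow> reflection_matrix (k *\<^sub>R u) = reflection_matrix u"
  by (simp add: reflection_matrix_def vec_eq_iff)

lemma continuous_on_reflection_matrix:
  fixes f :: "'a::topological_space \<Rightarrow> real^'n"
  assumes "continuous_on S f" "\<And>x. x \<in> S \<Longrightarrow> f x \<noteq> 0"
  shows "continuous_on S (\<lambda>x. reflection_matrix (f x))"
  unfolding reflection_matrix_def using assms by (intro continuous_intros) auto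

lemma det_reflection_matrix:
  fixes u :: "real^'n"
  assumes "CARD('n) \<ge> 2" "u \<noteq> 0"
  shows "det (reflection_matrix u) = -1"
proof -
  obtain k :: 'n where True by simp
  define e :: "real^'n" where "e = axis k 1"
  have e: "e \<bullet> e = 1" "e $ i = (if i = k then 1 else 0)" for i
    by (simp_all add: e_def dot_square_norm norm_axis_1) (simp add: axis_def)
  define v where "v = (1 / norm u) *\<^sub>R u"
  have "norm v = 1" using assms(2) by (simp add: v_def)
  then obtain A where A: "rotation_matrix A" "A *v e = v"
    using rotation_matrix_exists_basis[OF assms(1), of v k] unfolding e_def by metis
  have orth: "orthogonal_matrix A" using A(1) by (simp add: rotation_matrix_def)
  \<comment> \<open>All reflections are conjugate to the reflection in a coordinate hyperplane, which is diagonal.\<close>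
  have "A *v (reflection_matrix e *v (transpose A *v x)) = reflection_matrix v *v x" for x
  proof -
    have "A *v (transpose A *v x) = x"
      using orth by (metis matrix_vector_mul_assoc matrix_vector_mul_lid orthogonal_matrix_def)
    moreover have "e \<bullet> (transpose A *v x) = v \<bullet> x"
      using A(2) by (metis dot_lmul_matrix inner_commute vector_transpose_matrix)
    moreover have "v \<bullet> v = 1" using \<open>norm v = 1\<close> by (simp add: dot_square_norm)
    moreover note e(1)
    ultimately show ?thesis
      by (simp add: reflection_matrix_vector_mult matrix_vector_mult_diff_distrib
          matrix_vector_mult_scaleR A(2))
  qed
  then have "reflection_matrix v = A ** reflection_matrix e ** transpose A"
    unfolding matrix_eq matrix_vector_mul_assoc[symmetric] by (simp only: simp_thms)
  then have "det (reflection_matrix v) = det (reflection_matrix e)"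
    using A(1) by (simp add: det_mul rotation_matrix_def)
  also have "\<dots> = (\<Prod>i\<in>UNIV. reflection_matrix e $ i $ i)"
    by (intro det_diagonal) (auto simp: reflection_matrix_def e)
  also have "\<dots> = (\<Prod>i\<in>UNIV. if i = k then -1 else 1)"
    by (intro prod.cong) (auto simp: reflection_matrix_def e)
  also have "\<dots> = -1" by simp
  finally show ?thesis
    using assms(2) by (simp add: v_def reflection_matrix_scaleR)
qed

text \<open>The orthogonal matrices, of either determinant, that fix \<open>c\<close>.\<close>

definition orthogonal_stabiliser :: "real^'n \<Rightarrow> (real^'n^'n) set" where
  "orthogonal_stabiliser c = {A. orthogonal_matrix A \<and> A *v c = c}"

lemma orthogonal_stabiliser_mult:
  "A \<in> orthogonal_stabiliser c \<Longrightarrow> B \<in> orthogonal_stabiliser c \<Longrightarrow> A ** B \<in> orthogonal_stabiliser c"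
  by (simp add: orthogonal_stabiliser_def orthogonal_matrix_mul flip: matrix_vector_mul_assoc)

lemma reflection_matrix_in_stabiliser:
  "u \<noteq> 0 \<Longrightarrow> u \<bullet> c = 0 \<Longrightarrow> reflection_matrix u \<in> orthogonal_stabiliser c"
  by (simp add: orthogonal_stabiliser_def orthogonal_reflection_matrix reflection_matrix_fixes)

lemma path_component_stabiliser_mult_left:
  assumes "A \<in> orthogonal_stabiliser c" "path_component (orthogonal_stabiliser c) X Y"
  shows "path_component (orthogonal_stabiliser c) (A ** X) (A ** Y)"
  by (rule path_component_continuous_image[OF assms(2)])
     (auto intro!: continuous_intros orthogonal_stabiliser_mult assms(1))

text \<open>The normal vector moves along the segment from \<open>m\<close> to \<open>e\<close>. If this segment contains 0, then \<open>m\<close>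
and \<open>e\<close> are parallel and define the same reflection.\<close>

lemma path_component_reflections:
  assumes "m \<noteq> 0" "e \<noteq> 0" "m \<bullet> c = 0" "e \<bullet> c = 0"
  shows "path_component (orthogonal_stabiliser c) (reflection_matrix m) (reflection_matrix e)"
proof (cases "0 \<in> closed_segment m e")
  case True
  then obtain u where u: "0 \<le> u" "u \<le> 1" "(1 - u) *\<^sub>R m + u *\<^sub>R e = 0" by (auto simp: in_segment)
  have "u \<noteq> 1" "u \<noteq> 0" using u(3) assms by auto
  have eq: "(1 - u) *\<^sub>R m = (- u) *\<^sub>R e"
    using u(3) by (simp add: eq_neg_iff_add_eq_0)
  have "m = (1 / (1 - u)) *\<^sub>R ((1 - u) *\<^sub>R m)" using \<open>u \<noteq> 1\<close> by simp
  also have "\<dots> = (- u / (1 - u)) *\<^sub>R e" unfolding eq by simp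
  finally have "m = (- u / (1 - u)) *\<^sub>R e" .
  then have "reflection_matrix m = reflection_matrix e"
    using reflection_matrix_scaleR[of "- u / (1 - u)" e] \<open>u \<noteq> 1\<close> \<open>u \<noteq> 0\<close> by simp
  then show ?thesis
    using reflection_matrix_in_stabiliser[OF assms(2,4)] by (simp add: path_component_refl)
next
  case False
  show ?thesis
  proof (rule path_component_continuous_image[of "closed_segment m e" m e reflection_matrix])
    show "path_component (closed_segment m e) m e" by (rule path_component_linepath) simp
    show "continuous_on (closed_segment m e) reflection_matrix"
      using False by (intro continuous_on_reflection_matrix[where f = "\<lambda>x. x"] continuous_intros) auto
    show "reflection_matrix ` closed_segment m e \<subseteq> orthogonal_stabiliser c"
    proof (intro image_subsetI reflection_matrix_in_stabiliser)
      fix x assume "x \<in> closed_segment m e"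
      then show "x \<noteq> 0" "x \<bullet> c = 0"
        using False assms by (auto simp: in_segment inner_add_left)
    qed
  qed
qed

text \<open>The stabiliser has at most two path components. As in the theorem of Cartan and Dieudonne, a matrix
\<open>A\<close> with \<open>A *v x \<noteq> x\<close> is the product of the reflection with normal \<open>A *v x - x\<close> and a matrix \<open>B\<close>, which
fixes \<open>x\<close> and every vector fixed by \<open>A\<close>. The induction is on the codimension of the space of fixed vectors.\<close>

lemma stabiliser_path_components:
  fixes c e :: "real^'n"
  assumes e: "e \<noteq> 0" "e \<bullet> c = 0"
  shows "A \<in> orthogonal_stabiliser c \<Longrightarrow> path_component (orthogonal_stabiliser c) A (mat 1)
     \<or> path_component (orthogonal_stabiliser c) A (reflection_matrix e)"
proof (induction "CARD('n) - dim {x. A *v x = x}" arbitrary: A rule: less_induct)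
  case (less A)
  note A = less.prems
  have subspace: "subspace {x. B *v x = x}" for B :: "real^'n^'n"
    by (auto simp: subspace_def matrix_vector_right_distrib matrix_vector_mult_scaleR)
  have one: "mat 1 \<in> orthogonal_stabiliser c"
    by (simp add: orthogonal_stabiliser_def orthogonal_matrix_id)
  show ?case
  proof (cases "A = mat 1")
    case True
    then show ?thesis using one by (simp add: path_component_refl)
  next
    case False
    then obtain x where x: "A *v x \<noteq> x" by (metis matrix_eq matrix_vector_mul_lid)
    have "orthogonal_transformation ((*v) A)"
      using A by (simp add: orthogonal_transformation_matrix orthogonal_stabiliser_def)
    then have iso: "(A *v y) \<bullet> (A *v z) = y \<bullet> z" for y z
      by (simp add: orthogonal_transformation_def)
    define m where "m = A *v x - x"
    have "m \<noteq> 0" using x by (simp add: m_def)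
    have m_fix: "m \<bullet> z = 0" if "A *v z = z" for z
      using iso[of x z] that by (simp add: m_def inner_diff_left)
    have "m \<bullet> c = 0" using m_fix A by (simp add: orthogonal_stabiliser_def)
    note refl_m = reflection_matrix_in_stabiliser[OF \<open>m \<noteq> 0\<close> \<open>m \<bullet> c = 0\<close>]
    define B where "B = reflection_matrix m ** A"
    have B: "B \<in> orthogonal_stabiliser c"
      unfolding B_def by (intro orthogonal_stabiliser_mult refl_m A)
    have A_eq: "A = reflection_matrix m ** B"
      by (simp add: B_def matrix_mul_assoc reflection_matrix_involution[OF \<open>m \<noteq> 0\<close>])
    have "B *v x = x"
    proof -
      have "m \<bullet> m = 2 * (m \<bullet> (A *v x))"
        using iso[of x x] by (simp add: m_def inner_diff_left inner_diff_right inner_commute)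
      then have "2 * (m \<bullet> (A *v x)) / (m \<bullet> m) = (m \<bullet> m) / (m \<bullet> m)" by simp
      also have "\<dots> = 1" using \<open>m \<noteq> 0\<close> by simp
      finally have "2 * (m \<bullet> (A *v x)) / (m \<bullet> m) = 1" .
      then have "reflection_matrix m *v (A *v x) = A *v x - m"
        by (simp only: reflection_matrix_vector_mult scaleR_one)
      then show ?thesis by (simp add: B_def m_def flip: matrix_vector_mul_assoc)
    qed
    moreover have "B *v z = z" if "A *v z = z" for z
      using that m_fix[OF that] by (simp add: B_def reflection_matrix_fixes flip: matrix_vector_mul_assoc)
    ultimately have "{x. A *v x = x} \<subset> {x. B *v x = x}" using x by blast
    then have "dim {x. A *v x = x} < dim {x. B *v x = x}"
      by (intro dim_psubset) (simp add: span_eq_iff[THEN iffD2, OF subspace])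
    moreover have "dim {x. B *v x = x} \<le> CARD('n)"
      using dim_subset_UNIV[of "{x. B *v x = x}"] by simp
    ultimately have smaller: "CARD('n) - dim {x. B *v x = x} < CARD('n) - dim {x. A *v x = x}" by linarith
    note path_m_e = path_component_reflections[OF \<open>m \<noteq> 0\<close> e(1) \<open>m \<bullet> c = 0\<close> e(2)]
    from less.hyps[OF smaller B] show ?thesis
    proof
      assume "path_component (orthogonal_stabiliser c) B (mat 1)"
      from path_component_stabiliser_mult_left[OF refl_m this]
      show ?thesis using path_m_e path_component_trans unfolding A_eq by fastforce
    next
      assume "path_component (orthogonal_stabiliser c) B (reflection_matrix e)"
      from path_component_stabiliser_mult_left[OF refl_m this]
      have "path_component (orthogonal_stabiliser c) A (reflection_matrix m ** reflection_matrix e)"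
        by (simp add: A_eq)
      moreover have "path_component (orthogonal_stabiliser c)
          (reflection_matrix m ** reflection_matrix m) (reflection_matrix m ** reflection_matrix e)"
        by (rule path_component_stabiliser_mult_left[OF refl_m path_m_e])
      ultimately show ?thesis
        using path_component_sym path_component_trans
        unfolding reflection_matrix_involution[OF \<open>m \<noteq> 0\<close>] by blast
    qed
  qed
qed

lemma path_component_stabiliser_det:
  assumes "path_component (orthogonal_stabiliser c) A B"
  shows "det A = det B"
proof -
  have signs: "path_component {-1, 1 :: real} (det A) (det B)"
    by (rule path_component_continuous_image[OF assms])
       (auto intro!: continuous_intros simp: orthogonal_stabiliser_def dest: det_orthogonal_matrix)
  then obtain g where g: "path g" "path_image g \<subseteq> {-1, 1 :: real}" "pathstart g = det A" "pathfinish g = det B"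
    by (auto simp: path_component_def)
  have "connected (path_image g)" using g(1) by (rule connected_path_image)
  moreover have "finite (path_image g)" using g(2) finite_subset by blast
  ultimately obtain x where "path_image g \<subseteq> {x}"
    using connected_finite_iff_sing[of "path_image g"] by blast
  then show ?thesis
    using pathstart_in_path_image[of g] pathfinish_in_path_image[of g] g(3,4) by (metis singletonD subsetD)
qed

lemma rotation_stabiliser_path_component:
  fixes c :: "real^'n"
  assumes card: "CARD('n) \<ge> 2" and A: "rotation_matrix A" "A *v c = c"
  shows "path_component {A. rotation_matrix A \<and> A *v c = c} (mat 1) A"
proof -
  obtain e where "e \<noteq> 0" "orthogonal c e"
    using orthogonal_to_vector_exists[of c] card by auto
  then have e: "e \<noteq> 0" "e \<bullet> c = 0" by (auto simp: orthogonal_def inner_commute)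
  have "A \<in> orthogonal_stabiliser c" using A by (simp add: orthogonal_stabiliser_def rotation_matrix_def)
  moreover have "\<not> path_component (orthogonal_stabiliser c) A (reflection_matrix e)"
    using path_component_stabiliser_det det_reflection_matrix[OF card e(1)] A(1)
    by (fastforce simp: rotation_matrix_def)
  ultimately have "path_component (orthogonal_stabiliser c) (mat 1) A"
    using stabiliser_path_components[OF e] path_component_sym by blast
  then have "path_component (path_component_set (orthogonal_stabiliser c) (mat 1)) (mat 1) A"
    by (metis mem_Collect_eq path_component_path_component)
  moreover have "path_component_set (orthogonal_stabiliser c) (mat 1) \<subseteq> {A. rotation_matrix A \<and> A *v c = c}"
  proof
    fix B assume "B \<in> path_component_set (orthogonal_stabiliser c) (mat 1)"
    then have "det B = 1" "B \<in> orthogonal_stabiliser c"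
      using path_component_stabiliser_det[of c "mat 1" B] path_component_mem by force+
    then show "B \<in> {A. rotation_matrix A \<and> A *v c = c}"
      by (simp add: orthogonal_stabiliser_def rotation_matrix_def)
  qed
  ultimately show ?thesis by (rule path_component_of_subset[rotated])
qed

section \<open>Lifting paths of chords to rigid motions\<close>

text \<open>The rigid motions \<open>x \<mapsto> A *v x + w\<close> with \<open>A\<close> a rotation that map \<open>a\<close> and \<open>b\<close>, hence for convex \<open>K\<close> the
segment between them, into \<open>K\<close>.\<close>

definition configurations :: "(real^'n) set \<Rightarrow> real^'n \<Rightarrow> real^'n \<Rightarrow> ((real^'n^'n) \<times> (real^'n)) set" where
  "configurations K a b = {(A, w). rotation_matrix A \<and> A *v a + w \<in> K \<and> A *v b + w \<in> K}"

text \<open>The ends of the moved segment.\<close>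

definition chord_of :: "real^'n \<Rightarrow> real^'n \<Rightarrow> (real^'n^'n) \<times> (real^'n) \<Rightarrow> (real^'n) \<times> (real^'n)" where
  "chord_of a b X = (fst X *v a + snd X, fst X *v b + snd X)"

lemma rotation_matrix_mult:
  fixes A B :: "real^'n^'n"
  shows "rotation_matrix A \<Longrightarrow> rotation_matrix B \<Longrightarrow> rotation_matrix (A ** B)"
  by (simp add: rotation_matrix_def orthogonal_matrix_mul det_mul)

lemma rotation_matrix_transpose: "rotation_matrix A \<Longrightarrow> rotation_matrix (transpose A)"
  by (simp add: rotation_matrix_def orthogonal_matrix_def)

lemma configurations_same_chord:
  fixes K :: "(real^'n) set"
  assumes card: "CARD('n) \<ge> 2" and X: "X \<in> configurations K a b" and Y: "Y \<in> configurations K a b"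
    and chord: "chord_of a b X = chord_of a b Y"
  shows "path_component (configurations K a b) X Y"
proof -
  obtain A w where [simp]: "X = (A, w)" by (cases X)
  obtain B v where [simp]: "Y = (B, v)" by (cases Y)
  have rot: "rotation_matrix A" "rotation_matrix B" using X Y by (auto simp: configurations_def)
  define x y where "x = A *v a + w" and "y = A *v b + w"
  have ends: "x = B *v a + v" "y = B *v b + v" "x \<in> K" "y \<in> K"
    using X chord by (auto simp: configurations_def chord_of_def x_def y_def)
  have "A *v (b - a) = y - x" by (simp add: matrix_vector_mult_diff_distrib x_def y_def)
  have "B *v (b - a) = y - x" unfolding ends(1,2) by (simp add: matrix_vector_mult_diff_distrib)
  \<comment> \<open>The two configurations differ by a rotation \<open>Z\<close> that fixes \<open>b - a\<close>, applied first.\<close>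
  define Z where "Z = transpose A ** B"
  have inv: "transpose A ** A = mat 1" "A ** transpose A = mat 1"
    using rot(1) by (simp_all add: rotation_matrix_def orthogonal_matrix_def)
  have AZ: "A ** Z = B" by (simp add: Z_def matrix_mul_assoc inv)
  have "Z *v (b - a) = transpose A *v (A *v (b - a))"
    unfolding Z_def \<open>A *v (b - a) = y - x\<close> \<open>B *v (b - a) = y - x\<close>[symmetric]
    by (simp only: matrix_vector_mul_assoc)
  also have "\<dots> = b - a" by (simp only: matrix_vector_mul_assoc inv matrix_vector_mul_lid)
  finally have "Z *v (b - a) = b - a" .
  moreover have "rotation_matrix Z"
    unfolding Z_def by (intro rotation_matrix_mult rotation_matrix_transpose rot)
  ultimately have "path_component {Z. rotation_matrix Z \<and> Z *v (b - a) = b - a} (mat 1) Z"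
    by (intro rotation_stabiliser_path_component[OF card])
  then have "path_component (configurations K a b) (A ** mat 1, x - (A ** mat 1) *v a) (A ** Z, x - (A ** Z) *v a)"
  proof (rule path_component_continuous_image[where f = "\<lambda>Z. (A ** Z, x - (A ** Z) *v a)"])
    show "continuous_on {Z. rotation_matrix Z \<and> Z *v (b - a) = b - a} (\<lambda>Z. (A ** Z, x - (A ** Z) *v a))"
      by (intro continuous_intros)
    have "(A ** Z) *v b + (x - (A ** Z) *v a) = y" if "Z *v (b - a) = b - a" for Z
    proof -
      have "(A ** Z) *v (b - a) = y - x"
        using that \<open>A *v (b - a) = y - x\<close> by (simp flip: matrix_vector_mul_assoc)
      then show ?thesis by (simp add: matrix_vector_mult_diff_distrib algebra_simps)
    qed
    then show "(\<lambda>Z. (A ** Z, x - (A ** Z) *v a)) ` {Z. rotation_matrix Z \<and> Z *v (b - a) = b - a}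
        \<subseteq> configurations K a b"
      using ends(3,4) by (auto simp: configurations_def rotation_matrix_mult rot)
  qed
  moreover have "x - A *v a = w" by (simp add: x_def)
  moreover have "x - B *v a = v" by (simp add: ends(1))
  ultimately show ?thesis by (simp add: AZ)
qed

lemma configuration_over_chord:
  fixes a b x y :: "real^'n"
  assumes "CARD('n) \<ge> 2" "norm (b - a) = 1" "norm (y - x) = 1" "x \<in> K" "y \<in> K"
  obtains X where "X \<in> configurations K a b" "chord_of a b X = (x, y)"
proof -
  obtain f where f: "orthogonal_transformation f" "det (matrix f) = 1" "f (b - a) = y - x"
    using rotation_exists_1[OF assms(1-3)] by blast
  define A where "A = matrix f"
  have "linear f" using f(1) by (simp add: orthogonal_transformation_def)
  have rot: "rotation_matrix A"
    using f by (simp add: A_def rotation_matrix_def orthogonal_transformation_matrix)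
  have "A *v (b - a) = y - x" using matrix_vector_mul(2)[OF \<open>linear f\<close>] f(3) unfolding A_def by metis
  then have "A *v b + (x - A *v a) = y" by (simp add: matrix_vector_mult_diff_distrib algebra_simps)
  then show ?thesis
    using that[of "(A, x - A *v a)"] rot assms(4,5) by (simp add: configurations_def chord_of_def)
qed

text \<open>An explicit rotation from \<open>u\<close> to \<open>v\<close> that is continuous in \<open>v\<close> and equals the identity for \<open>v = u\<close>.\<close>

lemma rotation_between_unit_vectors:
  fixes u v :: "real^'n"
  assumes card: "CARD('n) \<ge> 2" and "norm u = 1" "norm v = 1" "u + v \<noteq> 0"
  defines "Q \<equiv> reflection_matrix (u + v) ** reflection_matrix u"
  shows "rotation_matrix Q" "Q *v u = v"
proof -
  have "u \<noteq> 0" using assms(2) by auto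
  show "rotation_matrix Q"
    unfolding rotation_matrix_def Q_def
    using \<open>u \<noteq> 0\<close> assms(4)
    by (simp add: orthogonal_matrix_mul orthogonal_reflection_matrix det_mul det_reflection_matrix[OF card])
  have uu: "u \<bullet> u = 1" "v \<bullet> v = 1" using assms by (simp_all add: dot_square_norm)
  have "reflection_matrix u *v u = - u"
    unfolding reflection_matrix_vector_mult uu by (simp add: algebra_simps scaleR_2)
  moreover have "reflection_matrix (u + v) *v (- u) = v"
  proof -
    have "(u + v) \<bullet> (u + v) = 2 * ((u + v) \<bullet> u)"
      using uu by (simp add: inner_add_left inner_add_right inner_commute)
    moreover have "(u + v) \<bullet> (u + v) \<noteq> 0" using assms(4) by simp
    ultimately have "2 * ((u + v) \<bullet> (- u)) / ((u + v) \<bullet> (u + v)) = - 1"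
      by (metis divide_self inner_minus_right minus_divide_left mult_minus_right)
    then have "reflection_matrix (u + v) *v (- u) = - u - (- 1) *\<^sub>R (u + v)"
      by (simp only: reflection_matrix_vector_mult)
    then show ?thesis by simp
  qed
  ultimately show "Q *v u = v" by (simp add: Q_def flip: matrix_vector_mul_assoc)
qed

text \<open>A path of chords whose direction never becomes opposite to the initial one lifts to configurations.\<close>

lemma configurations_lift_local:
  fixes K :: "(real^'n) set" and g :: "real \<Rightarrow> (real^'n) \<times> (real^'n)"
  assumes card: "CARD('n) \<ge> 2" and ab: "norm (b - a) = 1"
    and cont: "continuous_on (closed_segment s t) g"
    and unit: "\<And>r. r \<in> closed_segment s t \<Longrightarrow> g r \<in> K \<times> K \<and> norm (snd (g r) - fst (g r)) = 1"
    and near: "\<And>r. r \<in> closed_segment s t \<Longrightarrow> (snd (g s) - fst (g s)) + (snd (g r) - fst (g r)) \<noteq> 0"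
    and X: "X \<in> configurations K a b" "chord_of a b X = g s"
    and Y: "Y \<in> configurations K a b" "chord_of a b Y = g t"
  shows "path_component (configurations K a b) X Y"
proof -
  define u where "u r = snd (g r) - fst (g r)" for r
  obtain A w where X_eq: "X = (A, w)" by (cases X)
  have rot: "rotation_matrix A" using X by (simp add: configurations_def X_eq)
  have Au: "A *v (b - a) = u s" and w: "w = fst (g s) - A *v a"
    using X(2) by (auto simp: chord_of_def X_eq u_def matrix_vector_mult_diff_distrib
        dest!: sym[of _ "g s"])
  have us: "norm (u s) = 1" using unit[of s] by (simp add: u_def)
  then have "u s \<noteq> 0" by auto
  \<comment> \<open>The rotation \<open>Q r\<close> turns the direction \<open>u s\<close> into \<open>u r\<close>; the translation keeps the first end on the path.\<close>
  define Q where "Q r = reflection_matrix (u s + u r) ** reflection_matrix (u s)" for r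
  define F where "F r = (Q r ** A, fst (g r) - (Q r ** A) *v a)" for r
  have Q: "rotation_matrix (Q r)" "Q r *v u s = u r" if "r \<in> closed_segment s t" for r
    unfolding Q_def using unit[OF that] near[OF that] us
    by (auto intro!: rotation_between_unit_vectors card simp: u_def)
  have F: "F r \<in> configurations K a b \<and> chord_of a b (F r) = g r" if "r \<in> closed_segment s t" for r
  proof -
    have "(Q r ** A) *v (b - a) = u r" using Q(2)[OF that] Au by (simp flip: matrix_vector_mul_assoc)
    then have "(Q r ** A) *v b + (fst (g r) - (Q r ** A) *v a) = snd (g r)"
      by (simp add: matrix_vector_mult_diff_distrib u_def algebra_simps)
    then show ?thesis
      using unit[OF that] rotation_matrix_mult[OF Q(1)[OF that] rot]
      by (auto simp: F_def configurations_def chord_of_def mem_Times_iff)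
  qed
  have "path_component (configurations K a b) (F s) (F t)"
  proof (rule path_component_continuous_image[of "closed_segment s t" s t F])
    show "path_component (closed_segment s t) s t" by (rule path_component_linepath) simp
    have "continuous_on (closed_segment s t) u" unfolding u_def by (intro continuous_intros cont)
    then have "continuous_on (closed_segment s t) Q"
      unfolding Q_def using near \<open>u s \<noteq> 0\<close>
      by (intro continuous_intros continuous_on_reflection_matrix) (auto simp: u_def)
    then show "continuous_on (closed_segment s t) F"
      unfolding F_def by (intro continuous_intros cont)
    show "F ` closed_segment s t \<subseteq> configurations K a b" using F by blast
  qed
  moreover have "path_component (configurations K a b) X (F s)"
    using F[of s] X by (intro configurations_same_chord card) auto
  moreover have "path_component (configurations K a b) (F t) Y"
    using F[of t] Y by (intro configurations_same_chord card) auto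
  ultimately show ?thesis using path_component_trans by blast
qed

definition unit_chords :: "'a::real_normed_vector set \<Rightarrow> ('a \<times> 'a) set" where
  "unit_chords K = {(x, y). x \<in> K \<and> y \<in> K \<and> norm (y - x) = 1}"

lemma configurations_lift:
  fixes K :: "(real^'n) set"
  assumes card: "CARD('n) \<ge> 2" and ab: "norm (b - a) = 1"
    and X: "X \<in> configurations K a b" and Y: "Y \<in> configurations K a b"
    and chords: "path_component (unit_chords K) (chord_of a b X) (chord_of a b Y)"
  shows "path_component (configurations K a b) X Y"
proof -
  obtain g where g: "path g" "path_image g \<subseteq> unit_chords K"
      "pathstart g = chord_of a b X" "pathfinish g = chord_of a b Y"
    using chords by (auto simp: path_component_def)
  have cont: "continuous_on {0..1} g" using g(1) by (simp add: path_def)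
  have unit: "g r \<in> K \<times> K" "norm (snd (g r) - fst (g r)) = 1" if "r \<in> {0..1}" for r
    using g(2) that by (force simp: path_image_def unit_chords_def)+
  define R where "R s t \<longleftrightarrow> (\<forall>X\<in>configurations K a b. \<forall>Y\<in>configurations K a b.
     chord_of a b X = g s \<longrightarrow> chord_of a b Y = g t \<longrightarrow> path_component (configurations K a b) X Y)" for s t
  have over: "\<exists>X\<in>configurations K a b. chord_of a b X = g r" if "r \<in> {0..1}" for r
    using configuration_over_chord[OF card ab, of "snd (g r)" "fst (g r)" K] unit[OF that]
    by (metis mem_Times_iff prod.collapse)
  have R_sym: "R t s" if "R s t" for s t using that path_component_sym unfolding R_def by blast
  have R_trans: "R r t" if "R r s" "R s t" "s \<in> {0..1}" for r s t
    using over[OF that(3)] that(1,2) path_component_trans unfolding R_def by meson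
  have "R 0 1"
  proof (rule connected_equivalence_relation_gen[where S = "{0..1::real}" and P = "\<lambda>_. True"
        and R = "\<lambda>s t. s \<in> {0..1} \<and> t \<in> {0..1} \<and> R s t", THEN conjunct2, THEN conjunct2])
    show "\<exists>T. openin (top_of_set {0..1}) T \<and> s \<in> T \<and> (\<forall>x\<in>T. \<forall>y\<in>T. True \<and> True \<longrightarrow>
        x \<in> {0..1} \<and> y \<in> {0..1} \<and> R x y)" if s: "s \<in> {0..1}" for s
    proof -
      define u where "u r = snd (g r) - fst (g r)" for r
      have "continuous_on {0..1} u" unfolding u_def by (intro continuous_intros cont)
      then obtain d where d: "d > 0" "\<And>r. r \<in> {0..1} \<Longrightarrow> dist r s < d \<Longrightarrow> dist (u r) (u s) < 1"
        using s unfolding continuous_on_iff by (metis zero_less_one)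
      define T where "T = {0..1} \<inter> ball s d"
      have "R s t" if "t \<in> T" for t
      proof -
        have seg: "closed_segment s t \<subseteq> T"
          using that s d(1) by (intro closed_segment_subset) (auto simp: T_def convex_Int)
        have "u s + u r \<noteq> 0" if "r \<in> closed_segment s t" for r
        proof
          assume "u s + u r = 0"
          then have "u r - u s = - (2 *\<^sub>R u s)" by (simp add: scaleR_2 algebra_simps add_eq_0_iff)
          then have "dist (u r) (u s) = 2 * norm (u s)" by (simp add: dist_norm)
          moreover have "norm (u s) = 1" using unit(2)[OF s] by (simp add: u_def)
          moreover have "r \<in> T" using that seg by blast
          then have "dist (u r) (u s) < 1" using d(2)[of r] by (simp add: T_def dist_commute[of r s])
          ultimately show False by simp
        qed
        then have near: "(snd (g s) - fst (g s)) + (snd (g r) - fst (g r)) \<noteq> 0" if "r \<in> closed_segment s t" for r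
          using that by (simp add: u_def)
        have sub: "closed_segment s t \<subseteq> {0..1}" using seg by (auto simp: T_def)
        then have "g r \<in> K \<times> K \<and> norm (snd (g r) - fst (g r)) = 1" if "r \<in> closed_segment s t" for r
          using unit that by blast
        from configurations_lift_local[OF card ab continuous_on_subset[OF cont sub] this near]
        show ?thesis unfolding R_def by blast
      qed
      then have "R x y" if "x \<in> T" "y \<in> T" for x y
        using that R_sym R_trans[OF _ _ s] by blast
      then show ?thesis
        using s d(1) by (intro exI[of _ T]) (auto simp: T_def openin_open)
    qed
  qed (use R_trans in auto)
  then show ?thesis
    using g(3,4) X Y by (auto simp: R_def pathstart_def pathfinish_def)
qed

text \<open>Chords of length at least 1 are shortened to unit chords, keeping their first end and their direction.\<close>

lemma path_component_unit_chords:
  fixes K :: "'a::euclidean_space set"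
  assumes "convex K" "path_component (long_chords K) p q" "p \<in> unit_chords K" "q \<in> unit_chords K"
  shows "path_component (unit_chords K) p q"
proof -
  define f :: "'a \<times> 'a \<Rightarrow> 'a \<times> 'a"
    where "f r = (fst r, fst r + (1 / norm (snd r - fst r)) *\<^sub>R (snd r - fst r))" for r
  have "f r \<in> unit_chords K" if "r \<in> long_chords K" for r
  proof -
    obtain x y where r: "r = (x, y)" by (cases r)
    have xy: "x \<in> K" "y \<in> K" "1 \<le> norm (y - x)" using that by (auto simp: r long_chords_def)
    define t where "t = 1 / norm (y - x)"
    have "0 \<le> t" "t \<le> 1" using xy(3) by (auto simp: t_def divide_le_eq_1)
    then have "(1 - t) *\<^sub>R x + t *\<^sub>R y \<in> K" using xy by (intro convexD[OF assms(1)]) auto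
    then have "x + t *\<^sub>R (y - x) \<in> K" by (simp add: algebra_simps)
    moreover have "norm (y - x) \<noteq> 0" using xy(3) by linarith
    then have "norm (t *\<^sub>R (y - x)) = 1" by (simp add: t_def)
    ultimately show ?thesis using xy by (simp add: r f_def unit_chords_def flip: t_def)
  qed
  moreover have "continuous_on (long_chords K) f"
    unfolding f_def by (intro continuous_intros) (force simp: long_chords_def)
  ultimately have "path_component (unit_chords K) (f p) (f q)"
    by (intro path_component_continuous_image[OF assms(2)]) auto
  moreover have "f r = r" if "r \<in> unit_chords K" for r
    using that by (auto simp: f_def unit_chords_def)
  ultimately show ?thesis using assms(3,4) by simp
qed

lemma kakeya_body_unit_width:
  fixes K :: "(real^'n) set"
  assumes "convex_kakeya_body K"
  shows "unit_width_body K"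
proof
  show "compact K" "convex K" using assms by (simp_all add: convex_kakeya_body_def)
  fix v :: "real^'n"
  have chord: "\<exists>w\<in>K. w + u \<in> K" if "norm u = 1" for u
  proof -
    have "u \<in> sphere 0 1" using that by simp
    then have "\<exists>w\<in>K. \<forall>t\<in>{0..1}. w + t *\<^sub>R u \<in> K"
      using assms unfolding convex_kakeya_body_def by (elim conjE) (rule bspec)
    then obtain w where "w \<in> K" "\<forall>t\<in>{0..1}. w + t *\<^sub>R u \<in> K" by (elim bexE)
    moreover from this(2) have "w + 1 *\<^sub>R u \<in> K" by (rule bspec) simp
    ultimately show ?thesis by (intro bexI[of _ w]) simp_all
  qed
  show "\<exists>x\<in>K. \<exists>y\<in>K. norm v \<le> v \<bullet> (y - x)"
  proof (cases "v = 0")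
    case True
    then show ?thesis using chord[of "axis undefined 1"] by (auto simp: norm_axis_1)
  next
    case False
    then obtain w where w: "w \<in> K" "w + v /\<^sub>R norm v \<in> K" using chord[of "v /\<^sub>R norm v"] by auto
    have "v \<bullet> ((w + v /\<^sub>R norm v) - w) = norm v"
      using False by (simp add: dot_square_norm power2_eq_square)
    then show ?thesis using w by (metis order_refl)
  qed
qed

lemma rigid_copy_segment_subset_iff:
  assumes "convex K"
  shows "rigid_copy A w (closed_segment a b) \<subseteq> K \<longleftrightarrow> A *v a + w \<in> K \<and> A *v b + w \<in> K"
proof -
  have "rigid_copy A w (closed_segment a b) = (\<lambda>x. w + x) ` ((*v) A ` closed_segment a b)"
    by (simp add: rigid_copy_def image_image add.commute)
  also have "\<dots> = closed_segment (w + A *v a) (w + A *v b)"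
    by (simp add: closed_segment_linear_image closed_segment_translation)
  finally have image: "rigid_copy A w (closed_segment a b) = closed_segment (w + A *v a) (w + A *v b)" .
  have "closed_segment x y \<subseteq> K \<longleftrightarrow> x \<in> K \<and> y \<in> K" for x y
    using closed_segment_subset[of x K y] assms by auto
  then show ?thesis by (simp only: image add.commute)
qed

theorem theorem1p2:
  fixes K S :: "(real ^ 'n) set" and a b :: "real ^ 'n"
  assumes "CARD('n) \<ge> 2"
    and "convex_kakeya_body K"
    and "S = closed_segment a b" and "dist a b = 1"
  shows "copies_rotatable_within S K"
  unfolding copies_rotatable_within_def
proof (intro ballI allI impI, elim conjE)
  fix \<rho>\<^sub>0 \<rho>\<^sub>1 :: "real^'n^'n" and w\<^sub>0 w\<^sub>1
  assume rot: "\<rho>\<^sub>0 \<in> special_orthogonal" "\<rho>\<^sub>1 \<in> special_orthogonal"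
    and copies: "rigid_copy \<rho>\<^sub>0 w\<^sub>0 S \<subseteq> K" "rigid_copy \<rho>\<^sub>1 w\<^sub>1 S \<subseteq> K"
  interpret unit_width_body K by (rule kakeya_body_unit_width[OF assms(2)])
  have ab: "norm (b - a) = 1" using assms(4) by (simp add: dist_norm norm_minus_commute)
  note sub_iff = rigid_copy_segment_subset_iff[OF convex_K, of _ _ a b, folded assms(3)]
  have conf: "(\<rho>\<^sub>0, w\<^sub>0) \<in> configurations K a b" "(\<rho>\<^sub>1, w\<^sub>1) \<in> configurations K a b"
    using rot copies by (auto simp: configurations_def special_orthogonal_def sub_iff)
  have unit: "chord_of a b X \<in> unit_chords K" if "X \<in> configurations K a b" for X
  proof -
    obtain A w where X: "X = (A, w)" "rotation_matrix A" "A *v a + w \<in> K" "A *v b + w \<in> K"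
      using \<open>X \<in> configurations K a b\<close> by (auto simp: configurations_def)
    have "(A *v b + w) - (A *v a + w) = A *v (b - a)" by (simp add: matrix_vector_mult_diff_distrib)
    moreover have "norm (A *v (b - a)) = 1"
      using X(2) ab orthogonal_transformation_norm[of "(*v) A"]
      by (simp add: rotation_matrix_def orthogonal_transformation_matrix)
    ultimately show ?thesis using X by (simp add: unit_chords_def chord_of_def)
  qed
  have "unit_chords K \<subseteq> long_chords K" by (auto simp: unit_chords_def long_chords_def)
  then have "path_component (long_chords K) (chord_of a b (\<rho>\<^sub>0, w\<^sub>0)) (chord_of a b (\<rho>\<^sub>1, w\<^sub>1))"
    using path_connected_long_chords assms(1) unit[OF conf(1)] unit[OF conf(2)]
    by (auto simp: path_connected_component)
  then have "path_component (configurations K a b) (\<rho>\<^sub>0, w\<^sub>0) (\<rho>\<^sub>1, w\<^sub>1)"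
    by (intro configurations_lift assms(1) ab conf path_component_unit_chords convex_K unit)
  then obtain h where h: "path h" "path_image h \<subseteq> configurations K a b"
      "pathstart h = (\<rho>\<^sub>0, w\<^sub>0)" "pathfinish h = (\<rho>\<^sub>1, w\<^sub>1)"
    by (auto simp: path_component_def)
  have h_conf: "h t \<in> configurations K a b" if "t \<in> {0..1}" for t
    using h(2) that by (auto simp: path_image_def)
  show "\<exists>\<gamma> \<delta>. continuous_on {0..1::real} \<gamma> \<and> \<gamma> ` {0..1} \<subseteq> special_orthogonal \<and>
      continuous_on {0..1::real} \<delta> \<and> \<gamma> 0 = \<rho>\<^sub>0 \<and> \<gamma> 1 = \<rho>\<^sub>1 \<and> \<delta> 0 = w\<^sub>0 \<and> \<delta> 1 = w\<^sub>1 \<and>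
      (\<forall>t\<in>{0..1}. rigid_copy (\<gamma> t) (\<delta> t) S \<subseteq> K)"
  proof (intro exI conjI ballI)
    show "continuous_on {0..1} (\<lambda>t. fst (h t))" "continuous_on {0..1} (\<lambda>t. snd (h t))"
      using h(1) by (auto simp: path_def intro: continuous_intros)
    show "(\<lambda>t. fst (h t)) ` {0..1} \<subseteq> special_orthogonal"
      using h_conf by (force simp: configurations_def special_orthogonal_def)
    show "rigid_copy (fst (h t)) (snd (h t)) S \<subseteq> K" if "t \<in> {0..1}" for t
      using h_conf[OF that] unfolding sub_iff by (auto simp: configurations_def)
  qed (use h(3,4) in \<open>auto simp: pathstart_def pathfinish_def\<close>)
qed

end
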